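(* Let $(\mathcal{Y},g_{\mathcal{Y}})$ be a Riemannian manifold, let $\psi=\psi(r,y)$ be a positive smooth function on $M=\mathbb{R}\times\mathcal{Y}$, and equip $M$ with the metric $g=\mathrm{d}r^2+(\psi(r,y))^2g_{\mathcal{Y}}$, with Levi-Civita connection $\nabla$. Let $P$ denote the vector field $P=\psi\,\partial_r$. Then $$\nabla_{\partial_r}P=\frac{\partial\psi}{\partial r}\,\partial_r\qquad\text{and}\qquad \nabla_YP=Y(\psi)\,\partial_r+\frac{\partial\psi}{\partial r}\,Y$$ for every $Y$ tangent to the factor $\mathcal{Y}$. If $g$ is a warped product metric, then $P$ is a position vector field.
   Context: $r$ is the coordinate on the factor $\mathbb{R}$. The metric $g=\mathrm{d}r^2+\psi^2g_{\mathcal{Y}}$ is called a warped product metric when $\psi$ is a function of $r$ only. A vector field $P$ on a Riemannian manifold $M$ is a position vector field if there is a real function $\lambda$ on $M$ such that $\nabla_XP=\lambda X$ for all vector fields $X$ on $M$. *)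

theory Defs
  imports "HOL-Analysis.Analysis"
begin

section \<open>Model spaces and smooth maps between them\<close>

text \<open>The class \<open>euclidean_space\<close> requires positive dimension. Manifolds are modelled on
  the following class instead, which differs from it only in admitting dimension zero.\<close>

class finite_dim_inner = real_inner +
  assumes finite_spanning_set: "\<exists>B. finite B \<and> (\<forall>x. \<exists>c. x = (\<Sum>b\<in>B. c b *\<^sub>R b))"

lemma finite_dim_inner_iff_span:
  "(\<exists>B::'a::real_vector set. finite B \<and> (\<forall>x. \<exists>c. x = (\<Sum>b\<in>B. c b *\<^sub>R b))) \<longleftrightarrow>
     (\<exists>B::'a set. finite B \<and> span B = UNIV)"
proof -
  have "(\<forall>x. \<exists>c. x = (\<Sum>b\<in>B. c b *\<^sub>R b)) \<longleftrightarrow> span B = UNIV" if "finite B" for B :: "'a set"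
    unfolding span_finite[OF that] by (auto simp: image_iff set_eq_iff)
  then show ?thesis by blast
qed

instance euclidean_space \<subseteq> finite_dim_inner
proof
  show "\<exists>B::'a set. finite B \<and> (\<forall>x. \<exists>c. x = (\<Sum>b\<in>B. c b *\<^sub>R b))"
    unfolding finite_dim_inner_iff_span by (intro exI[of _ Basis]) simp
qed

instance prod :: (finite_dim_inner, finite_dim_inner) finite_dim_inner
proof
  obtain B :: "'a set" where B: "finite B" "span B = UNIV"
    using finite_spanning_set[where 'a='a] unfolding finite_dim_inner_iff_span by blast
  obtain C :: "'b set" where C: "finite C" "span C = UNIV"
    using finite_spanning_set[where 'a='b] unfolding finite_dim_inner_iff_span by blast
  have "(x, y) \<in> span (B \<times> {0} \<union> {0} \<times> C)" for x :: 'a and y :: 'b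
  proof -
    have l1: "linear (\<lambda>x::'a. (x, 0::'b))" and l2: "linear (\<lambda>y::'b. (0::'a, y))"
      by (auto intro!: linearI)
    have e1: "B \<times> {0} = (\<lambda>x::'a. (x, 0::'b)) ` B" and e2: "{0} \<times> C = (\<lambda>y::'b. (0::'a, y)) ` C"
      by auto
    have "(x, 0) \<in> span (B \<times> {0::'b})"
      unfolding e1 linear_span_image[OF l1] B(2) by simp
    moreover have "(0, y) \<in> span ({0::'a} \<times> C)"
      unfolding e2 linear_span_image[OF l2] C(2) by simp
    ultimately have "(x, 0) + (0, y) \<in> span (B \<times> {0} \<union> {0} \<times> C)"
      by (meson span_add span_mono Un_upper1 Un_upper2 subsetD)
    then show ?thesis by simp
  qed
  then have "span (B \<times> {0} \<union> {0} \<times> C) = (UNIV :: ('a \<times> 'b) set)" by auto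
  with B(1) C(1) show "\<exists>D::('a \<times> 'b) set. finite D \<and> (\<forall>x. \<exists>c. x = (\<Sum>b\<in>D. c b *\<^sub>R b))"
    unfolding finite_dim_inner_iff_span by (intro exI[of _ "B \<times> {0} \<union> {0} \<times> C"]) auto
qed

text \<open>Only used for open sets \<open>S\<close>; there \<open>ck_on k S f\<close> says that \<open>f\<close> is of class \<open>C\<^sup>k\<close> on \<open>S\<close>.\<close>

primrec ck_on :: "nat \<Rightarrow> 'e::finite_dim_inner set \<Rightarrow> ('e \<Rightarrow> 'f::finite_dim_inner) \<Rightarrow> bool" where
  "ck_on 0 S f \<longleftrightarrow> continuous_on S f"
| "ck_on (Suc k) S f \<longleftrightarrow>
     (\<forall>x\<in>S. f differentiable (at x)) \<and> (\<forall>v. ck_on k S (\<lambda>x. frechet_derivative f (at x) v))"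

definition smooth_on :: "'e::finite_dim_inner set \<Rightarrow> ('e \<Rightarrow> 'f::finite_dim_inner) \<Rightarrow> bool" where
  "smooth_on S f \<longleftrightarrow> (\<forall>k. ck_on k S f)"

section \<open>Smooth manifolds\<close>

text \<open>A manifold is a whole type \<open>'a\<close>, Hausdorff and second countable by its type classes,
  together with a smooth atlas, which need not be maximal. A chart \<open>(U, \<phi>)\<close> is relevant only
  through the values of \<open>\<phi>\<close> on \<open>U\<close>.\<close>

type_synonym ('a, 'e) chart = "'a set \<times> ('a \<Rightarrow> 'e)"

definition smooth_atlas ::
    "('a::{second_countable_topology,t2_space}, 'e::finite_dim_inner) chart set \<Rightarrow> bool" where
  "smooth_atlas A \<longleftrightarrow>
     (\<forall>(U, \<phi>)\<in>A. open U \<and> open (\<phi> ` U) \<and> homeomorphism U (\<phi> ` U) \<phi> (inv_into U \<phi>)) \<and>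
     (\<Union>(U, \<phi>)\<in>A. U) = UNIV \<and>
     (\<forall>(U, \<phi>)\<in>A. \<forall>(V, \<theta>)\<in>A. smooth_on (\<phi> ` (U \<inter> V)) (\<theta> \<circ> inv_into U \<phi>))"

definition smooth_fun_on ::
    "('a::topological_space, 'e::finite_dim_inner) chart set \<Rightarrow> 'a set \<Rightarrow> ('a \<Rightarrow> real) \<Rightarrow> bool" where
  "smooth_fun_on A W f \<longleftrightarrow>
     open W \<and> (\<forall>(U, \<phi>)\<in>A. smooth_on (\<phi> ` (U \<inter> W)) (f \<circ> inv_into U \<phi>))"

definition smooth_at ::
    "('a::topological_space, 'e::finite_dim_inner) chart set \<Rightarrow> 'a \<Rightarrow> ('a \<Rightarrow> real) \<Rightarrow> bool" where
  "smooth_at A p f \<longleftrightarrow> (\<exists>W. p \<in> W \<and> smooth_fun_on A W f)"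

section \<open>Tangent vectors and vector fields\<close>

text \<open>The tangent vector at \<open>t = 0\<close> of a smooth curve \<open>\<gamma>\<close> is the operator that differentiates
  functions along \<open>\<gamma>\<close>. It acts on the functions that are smooth near \<open>\<gamma> 0\<close>; it is extended by
  zero to all other functions, so that equality of operators is equality of tangent vectors.
  The vector space structure is the pointwise one.\<close>

type_synonym 'a tvec = "('a \<Rightarrow> real) \<Rightarrow> real"

definition smooth_curve ::
    "('a::topological_space, 'e::finite_dim_inner) chart set \<Rightarrow> (real \<Rightarrow> 'a) \<Rightarrow> bool" where
  "smooth_curve A \<gamma> \<longleftrightarrow>
     (\<exists>\<epsilon>>0. continuous_on {-\<epsilon><..<\<epsilon>} \<gamma> \<and>
        (\<forall>(U, \<phi>)\<in>A. smooth_on {t\<in>{-\<epsilon><..<\<epsilon>}. \<gamma> t \<in> U} (\<phi> \<circ> \<gamma>)))"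

definition velocity ::
    "('a::topological_space, 'e::finite_dim_inner) chart set \<Rightarrow> (real \<Rightarrow> 'a) \<Rightarrow> 'a tvec" where
  "velocity A \<gamma> = (\<lambda>f. if smooth_at A (\<gamma> 0) f then deriv (\<lambda>t. f (\<gamma> t)) 0 else 0)"

definition tangent_space ::
    "('a::topological_space, 'e::finite_dim_inner) chart set \<Rightarrow> 'a \<Rightarrow> 'a tvec set" where
  "tangent_space A p = {velocity A \<gamma> | \<gamma>. smooth_curve A \<gamma> \<and> \<gamma> 0 = p}"

text \<open>The differential at \<open>p\<close> of a map \<open>F\<close> into the manifold with atlas \<open>B\<close>.\<close>

definition differential ::
    "('b::topological_space, 'f::finite_dim_inner) chart set \<Rightarrow> ('a \<Rightarrow> 'b) \<Rightarrow> 'a \<Rightarrow> 'a tvec \<Rightarrow> 'b tvec"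
  where
  "differential B F p v = (\<lambda>h. if smooth_at B (F p) h then v (h \<circ> F) else 0)"

definition vector_field_on ::
    "('a::topological_space, 'e::finite_dim_inner) chart set \<Rightarrow> 'a set \<Rightarrow> ('a \<Rightarrow> 'a tvec) \<Rightarrow> bool" where
  "vector_field_on A W X \<longleftrightarrow>
     open W \<and> (\<forall>p\<in>W. X p \<in> tangent_space A p) \<and>
     (\<forall>V f. V \<subseteq> W \<and> smooth_fun_on A V f \<longrightarrow> smooth_fun_on A V (\<lambda>p. X p f))"

abbreviation vector_field ::
    "('a::topological_space, 'e::finite_dim_inner) chart set \<Rightarrow> ('a \<Rightarrow> 'a tvec) \<Rightarrow> bool" where
  "vector_field A X \<equiv> vector_field_on A UNIV X"

definition lie_bracket ::
    "('a::topological_space, 'e::finite_dim_inner) chart set \<Rightarrow>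
     ('a \<Rightarrow> 'a tvec) \<Rightarrow> ('a \<Rightarrow> 'a tvec) \<Rightarrow> 'a \<Rightarrow> 'a tvec" where
  "lie_bracket A X Y p =
     (\<lambda>f. if smooth_at A p f then X p (\<lambda>q. Y q f) - Y p (\<lambda>q. X q f) else 0)"

section \<open>Riemannian metrics and connections\<close>

type_synonym 'a metric = "'a \<Rightarrow> 'a tvec \<Rightarrow> 'a tvec \<Rightarrow> real"

definition riemannian_metric ::
    "('a::topological_space, 'e::finite_dim_inner) chart set \<Rightarrow> 'a metric \<Rightarrow> bool" where
  "riemannian_metric A g \<longleftrightarrow>
     (\<forall>p. \<forall>u\<in>tangent_space A p. \<forall>v\<in>tangent_space A p. \<forall>w\<in>tangent_space A p. \<forall>a b.
        g p (\<lambda>f. a * u f + b * v f) w = a * g p u w + b * g p v w) \<and>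
     (\<forall>p. \<forall>u\<in>tangent_space A p. \<forall>v\<in>tangent_space A p. g p u v = g p v u) \<and>
     (\<forall>p. \<forall>u\<in>tangent_space A p. u \<noteq> (\<lambda>f. 0) \<longrightarrow> g p u u > 0) \<and>
     (\<forall>W X Y. vector_field_on A W X \<and> vector_field_on A W Y \<longrightarrow>
        smooth_fun_on A W (\<lambda>p. g p (X p) (Y p)))"

type_synonym 'a connection = "('a \<Rightarrow> 'a tvec) \<Rightarrow> ('a \<Rightarrow> 'a tvec) \<Rightarrow> 'a \<Rightarrow> 'a tvec"

definition affine_connection ::
    "('a::topological_space, 'e::finite_dim_inner) chart set \<Rightarrow> 'a connection \<Rightarrow> bool" where
  "affine_connection A nab \<longleftrightarrow>
     (\<forall>X Y. vector_field A X \<and> vector_field A Y \<longrightarrow> vector_field A (nab X Y)) \<and>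
     (\<forall>X Y Z a b. vector_field A X \<and> vector_field A Y \<and> vector_field A Z \<and>
        smooth_fun_on A UNIV a \<and> smooth_fun_on A UNIV b \<longrightarrow>
        (\<forall>p. nab (\<lambda>q f. a q * X q f + b q * Y q f) Z p
              = (\<lambda>f. a p * nab X Z p f + b p * nab Y Z p f))) \<and>
     (\<forall>X Y Z. vector_field A X \<and> vector_field A Y \<and> vector_field A Z \<longrightarrow>
        (\<forall>p. nab X (\<lambda>q f. Y q f + Z q f) p = (\<lambda>f. nab X Y p f + nab X Z p f))) \<and>
     (\<forall>X Y a. vector_field A X \<and> vector_field A Y \<and> smooth_fun_on A UNIV a \<longrightarrow>
        (\<forall>p. nab X (\<lambda>q f. a q * Y q f) p = (\<lambda>f. a p * nab X Y p f + X p a * Y p f)))"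

definition torsion_free ::
    "('a::topological_space, 'e::finite_dim_inner) chart set \<Rightarrow> 'a connection \<Rightarrow> bool" where
  "torsion_free A nab \<longleftrightarrow>
     (\<forall>X Y p. vector_field A X \<and> vector_field A Y \<longrightarrow>
        (\<lambda>f. nab X Y p f - nab Y X p f) = lie_bracket A X Y p)"

definition metric_compatible ::
    "('a::topological_space, 'e::finite_dim_inner) chart set \<Rightarrow> 'a metric \<Rightarrow> 'a connection \<Rightarrow> bool"
  where
  "metric_compatible A g nab \<longleftrightarrow>
     (\<forall>X Y Z p. vector_field A X \<and> vector_field A Y \<and> vector_field A Z \<longrightarrow>
        X p (\<lambda>q. g q (Y q) (Z q)) = g p (nab X Y p) (Z p) + g p (Y p) (nab X Z p))"

definition levi_civita ::
    "('a::topological_space, 'e::finite_dim_inner) chart set \<Rightarrow> 'a metric \<Rightarrow> 'a connection \<Rightarrow> bool"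
  where
  "levi_civita A g nab \<longleftrightarrow>
     affine_connection A nab \<and> torsion_free A nab \<and> metric_compatible A g nab"

definition position_vector_field ::
    "('a::topological_space, 'e::finite_dim_inner) chart set \<Rightarrow> 'a connection \<Rightarrow> ('a \<Rightarrow> 'a tvec) \<Rightarrow> bool"
  where
  "position_vector_field A nab P \<longleftrightarrow>
     vector_field A P \<and>
     (\<exists>l. \<forall>X. vector_field A X \<longrightarrow> (\<forall>p. nab X P p = (\<lambda>f. l p * X p f)))"

section \<open>The product of the real line with a manifold\<close>

definition line_atlas :: "('a, 'e) chart set \<Rightarrow> (real \<times> 'a, real \<times> 'e) chart set" where
  "line_atlas A = (\<lambda>(U, \<phi>). (UNIV \<times> U, map_prod id \<phi>)) ` A"

text \<open>\<open>radial_field A\<close> is the coordinate field \<open>\<partial>\<^sub>r\<close>: its value at \<open>(r, y)\<close> is the velocity of the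
  \<open>r\<close>-line through \<open>(r, y)\<close>.\<close>

definition radial_field ::
    "('a::topological_space, 'e::finite_dim_inner) chart set \<Rightarrow> real \<times> 'a \<Rightarrow> (real \<times> 'a) tvec" where
  "radial_field A p = velocity (line_atlas A) (\<lambda>t. (fst p + t, snd p))"

definition partial_r :: "(real \<times> 'a \<Rightarrow> real) \<Rightarrow> real \<times> 'a \<Rightarrow> real" where
  "partial_r \<psi> p = deriv (\<lambda>r. \<psi> (r, snd p)) (fst p)"

text \<open>The tangent vectors at \<open>p = (r, y)\<close> that come from the factor \<open>{r} \<times> \<Y>\<close>.\<close>

definition factor_tangent_space ::
    "('a::topological_space, 'e::finite_dim_inner) chart set \<Rightarrow> real \<times> 'a \<Rightarrow> (real \<times> 'a) tvec set" where
  "factor_tangent_space A p =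
     differential (line_atlas A) (Pair (fst p)) (snd p) ` tangent_space A (snd p)"

text \<open>The metric \<open>dr\<^sup>2 + \<psi>\<^sup>2 g\<^sub>\<Y>\<close>. The coordinate \<open>r\<close> is the function \<open>fst\<close>, hence \<open>dr(v) = v fst\<close>,
  and \<open>g\<^sub>\<Y>\<close> is pulled back along the projection \<open>snd\<close>.\<close>

definition twisted_metric ::
    "('a::topological_space, 'e::finite_dim_inner) chart set \<Rightarrow> (real \<times> 'a \<Rightarrow> real) \<Rightarrow>
     'a metric \<Rightarrow> (real \<times> 'a) metric" where
  "twisted_metric A \<psi> gY p v w =
     v fst * w fst + (\<psi> p)\<^sup>2 * gY (snd p) (differential A snd p v) (differential A snd p w)"

text \<open>The metric \<open>twisted_metric A \<psi> gY\<close> is a warped product metric.\<close>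

definition warped_product :: "(real \<times> 'a \<Rightarrow> real) \<Rightarrow> bool" where
  "warped_product \<psi> \<longleftrightarrow> (\<exists>f. \<forall>r y. \<psi> (r, y) = f r)"

end

theory Submission
  imports Defs
begin

text \<open>Write \<open>\<partial>\<^sub>r\<close> for the radial field, \<open>\<pi>\<close> for the projection of \<open>\<real> \<times> \<Y>\<close> to \<open>\<Y>\<close>, and \<open>X r\<close> for
  the function \<open>dr(X)\<close>. By the Leibniz rule \<open>\<nabla>\<^sub>X P = \<psi> \<nabla>\<^sub>X \<partial>\<^sub>r + X(\<psi>) \<partial>\<^sub>r\<close>, so everything follows from
  \<open>\<psi> \<nabla>\<^sub>X \<partial>\<^sub>r = (\<partial>\<psi>/\<partial>r) (X - (X r) \<partial>\<^sub>r)\<close>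
  for every vector field \<open>X\<close> (\<open>connection_radial\<close>). For \<open>X = \<partial>\<^sub>r\<close> the right-hand side vanishes; where
  \<open>X\<close> is tangent to \<open>\<Y>\<close> the term \<open>X r\<close> vanishes; and if \<open>\<psi>\<close> depends on \<open>r\<close> only then
  \<open>X(\<psi>) = (X r) \<partial>\<psi>/\<partial>r\<close>, so the two multiples of \<open>\<partial>\<^sub>r\<close> cancel and \<open>\<nabla>\<^sub>X P = (\<partial>\<psi>/\<partial>r) X\<close>.

  The formula for \<open>\<nabla>\<^sub>X \<partial>\<^sub>r\<close> rests on two facts. Since \<open>g(\<partial>\<^sub>r, \<cdot>) = dr\<close> is closed, the Koszul formula
  reduces to \<open>2 g(\<nabla>\<^sub>X \<partial>\<^sub>r, Z) = (L g)(X, Z)\<close>, where \<open>L\<close> is the Lie derivative along \<open>\<partial>\<^sub>r\<close>. The pullback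
  \<open>\<pi>\<^sup>* g\<^sub>\<Y>\<close> is constant along the \<open>r\<close>-lines, so that \<open>L g = 2 \<psi> (\<partial>\<psi>/\<partial>r) \<pi>\<^sup>* g\<^sub>\<Y>\<close>
  (\<open>radial_derivative_twisted_metric\<close>). Together they give
  \<open>g(\<nabla>\<^sub>X \<partial>\<^sub>r, Z) = \<psi> (\<partial>\<psi>/\<partial>r) g\<^sub>\<Y>(\<pi>\<^sub>* X, \<pi>\<^sub>* Z)\<close> (\<open>koszul_radial\<close>), which says that
  \<open>S = \<psi> \<nabla>\<^sub>X \<partial>\<^sub>r - (\<partial>\<psi>/\<partial>r) (X - (X r) \<partial>\<^sub>r)\<close> is orthogonal to every vector field \<open>Z\<close>. As \<open>S\<close> is itself
  a vector field on the whole manifold, the choice \<open>Z = S\<close> is admissible and gives \<open>S = 0\<close>.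

  The constancy of \<open>\<pi>\<^sup>* g\<^sub>\<Y>\<close> is seen in coordinates: in a chart of \<open>\<Y>\<close> the function
  \<open>g\<^sub>\<Y>(\<pi>\<^sub>* X, \<pi>\<^sub>* Z)\<close> is a sum of terms \<open>X\<^sup>b Z\<^sup>c G\<^sub>b\<^sub>c\<close> whose coefficients \<open>G\<^sub>b\<^sub>c\<close> are independent of \<open>r\<close>.
  This needs the expansion of a tangent vector, defined as the velocity operator of a curve, in
  coordinate vectors; the sections before the geometry supply it, together with the calculus of
  smooth maps on which it depends.\<close>

section \<open>Parseval frames\<close>

text \<open>The model spaces carry an inner product but no distinguished basis. Normalising the nonzero
  vectors of an orthogonal spanning set gives an orthonormal basis, for which the
  reproducing formula holds.\<close>

lemma finite_Parseval_frame:
  "\<exists>B::'a::finite_dim_inner set. finite B \<and> (\<forall>v. (\<Sum>b\<in>B. (v \<bullet> b) *\<^sub>R b) = v)"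
proof -
  obtain B0 :: "'a set" where B0: "finite B0" "span B0 = UNIV"
    using finite_spanning_set[where 'a='a] unfolding finite_dim_inner_iff_span by blast
  obtain C where C: "finite C" "span C = span B0" "pairwise orthogonal C"
    using basis_orthogonal[OF B0(1)] by blast
  define B where "B = (\<lambda>c. c /\<^sub>R norm c) ` (C - {0})"
  have finB: "finite B" using C(1) by (simp add: B_def)
  have orth: "b \<bullet> c = (if b = c then 1 else 0)" if bc: "b \<in> B" "c \<in> B" for b c
  proof -
    obtain b' where "b = b' /\<^sub>R norm b'" "b' \<in> C - {0}"
      using bc(1) unfolding B_def by (rule imageE)
    then have b': "b' \<in> C" "b' \<noteq> 0" "b = b' /\<^sub>R norm b'" by auto
    obtain c' where "c = c' /\<^sub>R norm c'" "c' \<in> C - {0}"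
      using bc(2) unfolding B_def by (rule imageE)
    then have c': "c' \<in> C" "c' \<noteq> 0" "c = c' /\<^sub>R norm c'" by auto
    show ?thesis
    proof (cases "b' = c'")
      case True
      then have "b = c" using b'(3) c'(3) by simp
      moreover have "b \<bullet> b = 1" using b'(2) by (simp add: b'(3) dot_square_norm power2_eq_square)
      ultimately show ?thesis by simp
    next
      case False
      then have "b' \<bullet> c' = 0" using C(3) b' c' by (auto simp: pairwise_def orthogonal_def)
      then have "b \<bullet> c = 0" by (simp add: b'(3) c'(3))
      moreover have "b \<bullet> b = 1" using b'(2) by (simp add: b'(3) dot_square_norm power2_eq_square)
      ultimately show ?thesis by (cases "b = c") simp_all
    qed
  qed
  have "c \<in> span B" if "c \<in> C" for c
  proof (cases "c = 0")
    case False
    then have "c /\<^sub>R norm c \<in> B" using that by (auto simp: B_def)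
    then have "norm c *\<^sub>R (c /\<^sub>R norm c) \<in> span B" by (intro span_mul span_base)
    then show ?thesis using False by simp
  qed (simp add: span_0)
  then have "span B = UNIV" using span_minimal[of C "span B"] C(2) B0(2) by auto
  then have "(\<Sum>b\<in>B. (v \<bullet> b) *\<^sub>R b) = v" for v
  proof -
    have "v \<in> span B" by (simp add: \<open>span B = UNIV\<close>)
    then obtain u where u: "v = (\<Sum>b\<in>B. u b *\<^sub>R b)"
      unfolding span_finite[OF finB] by (rule imageE)
    have "v \<bullet> b = u b" if "b \<in> B" for b
    proof -
      have "v \<bullet> b = (\<Sum>c\<in>B. u c * (c \<bullet> b))" by (simp add: u inner_sum_left)
      also have "\<dots> = (\<Sum>c\<in>B. if c = b then u c else 0)"
        using orth that by (intro sum.cong) auto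
      finally show ?thesis using finB that by simp
    qed
    then have "(\<Sum>b\<in>B. (v \<bullet> b) *\<^sub>R b) = (\<Sum>b\<in>B. u b *\<^sub>R b)" by (intro sum.cong) auto
    with u show ?thesis by simp
  qed
  then show ?thesis using finB by blast
qed

definition frame :: "'a::finite_dim_inner set" where
  "frame = (SOME B. finite B \<and> (\<forall>v. (\<Sum>b\<in>B. (v \<bullet> b) *\<^sub>R b) = v))"

lemma finite_frame [simp]: "finite (frame :: 'a::finite_dim_inner set)"
  and frame_expansion: "(\<Sum>b\<in>frame. (v \<bullet> b) *\<^sub>R b) = (v :: 'a)"
  using someI_ex[OF finite_Parseval_frame[where 'a='a]] unfolding frame_def by auto

lemma linear_frame_expansion:
  assumes "linear L"
  shows "L v = (\<Sum>b\<in>frame. (v \<bullet> b) *\<^sub>R L b)"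
proof -
  have "L v = L (\<Sum>b\<in>frame. (v \<bullet> b) *\<^sub>R b)" by (simp only: frame_expansion)
  then show ?thesis by (simp add: linear_sum[OF assms] linear_scale[OF assms])
qed

section \<open>Calculus of smooth maps\<close>

lemma frechet_derivative_cong_open:
  assumes "open S" "x \<in> S" "\<And>y. y \<in> S \<Longrightarrow> f y = g y"
  shows "frechet_derivative f (at x) = frechet_derivative g (at x)"
proof -
  have "(f has_derivative D) (at x) \<longleftrightarrow> (g has_derivative D) (at x)" for D
    using has_derivative_transform_within_open[OF _ assms(1,2), of f D UNIV g]
      has_derivative_transform_within_open[OF _ assms(1,2), of g D UNIV f] assms(3) by auto
  then show ?thesis unfolding frechet_derivative_def by simp
qed

lemma differentiable_cong_open:
  assumes "open S" "x \<in> S" "\<And>y. y \<in> S \<Longrightarrow> f y = g y" "f differentiable (at x)"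
  shows "g differentiable (at x)"
  using assms(4) has_derivative_transform_within_open[OF _ assms(1,2), of f _ UNIV g] assms(3)
  unfolding differentiable_def by blast

lemma ck_on_cong:
  assumes "open S" "\<And>x. x \<in> S \<Longrightarrow> f x = g x" "ck_on k S f"
  shows "ck_on k S g"
  using assms(2,3)
proof (induction k arbitrary: f g)
  case 0
  then show ?case using continuous_on_cong[of S S f g] by simp
next
  case (Suc k)
  have d: "frechet_derivative f (at x) = frechet_derivative g (at x)" if "x \<in> S" for x
    using frechet_derivative_cong_open[OF assms(1) that] Suc.prems(1) by blast
  have "ck_on k S (\<lambda>x. frechet_derivative g (at x) v)" for v
    by (rule Suc.IH[of "\<lambda>x. frechet_derivative f (at x) v"]) (use d Suc.prems(2) in auto)
  moreover have "g differentiable (at x)" if "x \<in> S" for x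
    by (rule differentiable_cong_open[OF assms(1) that, of f]) (use Suc.prems that in auto)
  ultimately show ?case by simp
qed

lemma ck_on_subset: "ck_on k S f \<Longrightarrow> T \<subseteq> S \<Longrightarrow> ck_on k T f"
  by (induction k arbitrary: f) (auto intro: continuous_on_subset)

lemma ck_on_Suc_imp: "ck_on (Suc k) S f \<Longrightarrow> ck_on k S f"
proof (induction k arbitrary: f)
  case 0
  then show ?case
    by (auto intro!: continuous_at_imp_continuous_on differentiable_imp_continuous_within)
next
  case (Suc k)
  from Suc.prems have "ck_on (Suc k) S (\<lambda>x. frechet_derivative f (at x) v)" for v by simp
  then have "ck_on k S (\<lambda>x. frechet_derivative f (at x) v)" for v by (rule Suc.IH)
  then show ?case using Suc.prems by simp
qed

lemma ck_on_derivative: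
  assumes "ck_on (Suc k) S f"
  shows "ck_on k S (\<lambda>x. frechet_derivative f (at x) v)"
    and "x \<in> S \<Longrightarrow> (f has_derivative frechet_derivative f (at x)) (at x)"
  using assms by (auto simp: frechet_derivative_works)

lemma ck_on_SucI:
  assumes "open S" "\<And>x. x \<in> S \<Longrightarrow> (f has_derivative D x) (at x)"
    "\<And>v. ck_on k S (\<lambda>x. D x v)"
  shows "ck_on (Suc k) S f"
proof -
  have "frechet_derivative f (at x) = D x" if "x \<in> S" for x
    using assms(2)[OF that] by (rule frechet_derivative_at[symmetric])
  then have "ck_on k S (\<lambda>x. frechet_derivative f (at x) v)" for v
    by (intro ck_on_cong[OF assms(1) _ assms(3)[of v]]) simp
  then show ?thesis using assms(2) by (auto simp: differentiable_def)
qed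

lemma ck_on_const: "open S \<Longrightarrow> ck_on k S (\<lambda>x. c)"
proof (induction k arbitrary: c)
  case (Suc k)
  show ?case by (rule ck_on_SucI[OF Suc.prems, of _ "\<lambda>x v. 0"]) (use Suc in auto)
qed simp

lemma ck_on_bounded_linear:
  assumes "open S" "bounded_linear h"
  shows "ck_on k S h"
proof (cases k)
  case 0
  then show ?thesis using assms by (simp add: linear_continuous_on)
next
  case (Suc k')
  show ?thesis unfolding Suc
    by (rule ck_on_SucI[OF assms(1), of _ "\<lambda>x. h"])
      (use assms in \<open>auto intro: bounded_linear_imp_has_derivative ck_on_const\<close>)
qed

lemma ck_on_add:
  assumes "open S"
  shows "ck_on k S f \<Longrightarrow> ck_on k S g \<Longrightarrow> ck_on k S (\<lambda>x. f x + g x)"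
proof (induction k arbitrary: f g)
  case 0
  then show ?case by (simp add: continuous_on_add)
next
  case (Suc k)
  show ?case
    by (rule ck_on_SucI[OF assms, of _ "\<lambda>x v. frechet_derivative f (at x) v + frechet_derivative g (at x) v"])
      (use Suc ck_on_derivative in \<open>auto intro!: has_derivative_add simp: frechet_derivative_works\<close>)
qed

lemma ck_on_sum:
  assumes "open S" "finite I" "\<And>i. i \<in> I \<Longrightarrow> ck_on k S (f i)"
  shows "ck_on k S (\<lambda>x. \<Sum>i\<in>I. f i x)"
  using assms(2,3) by (induction I rule: finite_induct) (auto simp: ck_on_const ck_on_add assms(1))

text \<open>The product rule expresses a derivative of \<open>m (f x) (g x)\<close> through the products of \<open>f\<close> with a
  derivative of \<open>g\<close> and of a derivative of \<open>f\<close> with \<open>g\<close>, to which the induction hypothesis applies.\<close>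

lemma ck_on_bilinear:
  assumes "open S" "bounded_bilinear m"
  shows "ck_on k S f \<Longrightarrow> ck_on k S g \<Longrightarrow> ck_on k S (\<lambda>x. m (f x) (g x))"
proof (induction k arbitrary: f g)
  case 0
  then show ?case by (simp add: bounded_bilinear.continuous_on[OF assms(2)])
next
  case (Suc k)
  show ?case
  proof (rule ck_on_SucI[OF assms(1)])
    fix x assume "x \<in> S"
    then show "((\<lambda>x. m (f x) (g x)) has_derivative (\<lambda>v. m (f x) (frechet_derivative g (at x) v)
        + m (frechet_derivative f (at x) v) (g x))) (at x)"
      using Suc.prems by (intro bounded_bilinear.FDERIV[OF assms(2)] ck_on_derivative)
  next
    fix v
    show "ck_on k S (\<lambda>x. m (f x) (frechet_derivative g (at x) v)
        + m (frechet_derivative f (at x) v) (g x))"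
      using Suc.prems by (intro ck_on_add Suc.IH ck_on_derivative assms(1)) (auto intro: ck_on_Suc_imp simp del: ck_on.simps)
  qed
qed

text \<open>The class \<open>C\<^sup>k\<close> is defined through derivatives in fixed directions, but in the chain rule the
  direction \<open>Dg(x) v\<close> varies with \<open>x\<close>. Expanding it in a frame writes the derivative of \<open>f \<circ> g\<close> as a
  finite sum of products of maps \<open>\<langle>Dg(x) v, b\<rangle>\<close> and \<open>Df(g x) b\<close>, each of class one less.\<close>

lemma ck_on_compose:
  assumes "open S" "open T"
  shows "ck_on k T f \<Longrightarrow> ck_on k S g \<Longrightarrow> g ` S \<subseteq> T \<Longrightarrow> ck_on k S (f \<circ> g)"
proof (induction k arbitrary: f g)
  case 0
  then have "continuous_on (g ` S) f" "continuous_on S g" by (auto elim: continuous_on_subset)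
  then have "continuous_on S (f \<circ> g)" by (intro continuous_on_compose)
  then show ?case by simp
next
  case (Suc k)
  let ?Df = "\<lambda>y. frechet_derivative f (at y)" and ?Dg = "\<lambda>x. frechet_derivative g (at x)"
  have Df: "(f has_derivative ?Df (g x)) (at (g x))" if "x \<in> S" for x
    using Suc.prems that by (intro ck_on_derivative) auto
  have Dg: "(g has_derivative ?Dg x) (at x)" if "x \<in> S" for x
    using Suc.prems(2) that by (rule ck_on_derivative)
  have gk: "ck_on k S g" using Suc.prems(2) by (rule ck_on_Suc_imp)
  show ?case
  proof (rule ck_on_SucI[OF assms(1)])
    fix x assume x: "x \<in> S"
    have "?Df (g x) \<circ> ?Dg x = (\<lambda>v. \<Sum>b\<in>frame. (?Dg x v \<bullet> b) *\<^sub>R ?Df (g x) b)"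
      unfolding o_def
      by (rule ext) (rule linear_frame_expansion[OF has_derivative_linear[OF Df[OF x]]])
    with diff_chain_at[OF Dg[OF x] Df[OF x]]
    show "((f \<circ> g) has_derivative (\<lambda>v. \<Sum>b\<in>frame. (?Dg x v \<bullet> b) *\<^sub>R ?Df (g x) b)) (at x)"
      by simp
  next
    fix v
    have "ck_on k S ((\<lambda>y. ?Df y b) \<circ> g)" for b
      using Suc.prems by (intro Suc.IH gk ck_on_derivative) auto
    then have Df_g: "ck_on k S (\<lambda>x. ?Df (g x) b)" for b by (simp add: o_def)
    have Dg_b: "ck_on k S (\<lambda>x. ?Dg x v \<bullet> b)" for b
      by (rule ck_on_bilinear[OF assms(1) bounded_bilinear_inner ck_on_derivative(1)[OF Suc.prems(2)]
            ck_on_const[OF assms(1)]])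
    show "ck_on k S (\<lambda>x. \<Sum>b\<in>frame. (?Dg x v \<bullet> b) *\<^sub>R ?Df (g x) b)"
      by (rule ck_on_sum[OF assms(1) finite_frame
            ck_on_bilinear[OF assms(1) bounded_bilinear_scaleR Dg_b Df_g]])
  qed
qed

lemma smooth_on_cong: "smooth_on S f \<Longrightarrow> open S \<Longrightarrow> (\<And>x. x \<in> S \<Longrightarrow> f x = g x) \<Longrightarrow> smooth_on S g"
  unfolding smooth_on_def by (metis ck_on_cong)

lemma smooth_on_subset: "smooth_on S f \<Longrightarrow> T \<subseteq> S \<Longrightarrow> smooth_on T f"
  unfolding smooth_on_def by (metis ck_on_subset)

lemma smooth_on_const: "open S \<Longrightarrow> smooth_on S (\<lambda>x. c)"
  unfolding smooth_on_def by (simp add: ck_on_const)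

lemma smooth_on_add: "smooth_on S f \<Longrightarrow> smooth_on S g \<Longrightarrow> open S \<Longrightarrow> smooth_on S (\<lambda>x. f x + g x)"
  unfolding smooth_on_def by (metis ck_on_add)

lemma smooth_on_mult:
  "smooth_on S f \<Longrightarrow> smooth_on S g \<Longrightarrow> open S \<Longrightarrow> smooth_on S (\<lambda>x. f x * g x :: real)"
  unfolding smooth_on_def by (metis ck_on_bilinear[OF _ bounded_bilinear_mult])

lemma smooth_on_bounded_linear: "bounded_linear h \<Longrightarrow> open S \<Longrightarrow> smooth_on S h"
  unfolding smooth_on_def by (metis ck_on_bounded_linear)

lemma smooth_on_compose:
  "smooth_on T f \<Longrightarrow> smooth_on S g \<Longrightarrow> g ` S \<subseteq> T \<Longrightarrow> open S \<Longrightarrow> open T \<Longrightarrow> smooth_on S (f \<circ> g)"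
  unfolding smooth_on_def by (metis ck_on_compose)

lemma smooth_on_directional_derivative:
  "smooth_on S f \<Longrightarrow> smooth_on S (\<lambda>x. frechet_derivative f (at x) v)"
  unfolding smooth_on_def by (metis ck_on.simps(2))

lemma smooth_on_has_derivative:
  "smooth_on S f \<Longrightarrow> x \<in> S \<Longrightarrow> (f has_derivative frechet_derivative f (at x)) (at x)"
  unfolding smooth_on_def by (metis ck_on_derivative(2))

text \<open>The pair is \<open>(f x, 0) + (0, g x)\<close>, a sum of compositions with linear maps.\<close>

lemma smooth_on_Pair:
  assumes "smooth_on S f" "smooth_on S g" "open S"
  shows "smooth_on S (\<lambda>x. (f x, g x))"
proof -
  have "smooth_on S ((\<lambda>y. (y, 0)) \<circ> f)"
    by (rule smooth_on_compose[of UNIV])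
      (use assms in \<open>auto intro!: smooth_on_bounded_linear bounded_linear_Pair bounded_linear_ident bounded_linear_zero\<close>)
  moreover have "smooth_on S ((\<lambda>y. (0, y)) \<circ> g)"
    by (rule smooth_on_compose[of UNIV])
      (use assms in \<open>auto intro!: smooth_on_bounded_linear bounded_linear_Pair bounded_linear_ident bounded_linear_zero\<close>)
  ultimately have "smooth_on S (\<lambda>x. ((\<lambda>y. (y, 0)) \<circ> f) x + ((\<lambda>y. (0, y)) \<circ> g) x)"
    using assms(3) by (rule smooth_on_add)
  then show ?thesis by (simp add: o_def)
qed

section \<open>Smooth functions in charts\<close>

lemma chartD:
  assumes "smooth_atlas A" "(U, \<phi>) \<in> A"
  shows "open U" "open (\<phi> ` U)" "inj_on \<phi> U" "continuous_on U \<phi>"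
    "continuous_on (\<phi> ` U) (inv_into U \<phi>)" "homeomorphism U (\<phi> ` U) \<phi> (inv_into U \<phi>)"
proof -
  have "open U \<and> open (\<phi> ` U) \<and> homeomorphism U (\<phi> ` U) \<phi> (inv_into U \<phi>)"
    using assms(1)[unfolded smooth_atlas_def, THEN conjunct1, THEN bspec, OF assms(2)]
    by (simp only: prod.case)
  then show "open U" "open (\<phi> ` U)" and h: "homeomorphism U (\<phi> ` U) \<phi> (inv_into U \<phi>)"
    by blast+
  show "continuous_on U \<phi>" "continuous_on (\<phi> ` U) (inv_into U \<phi>)"
    using h by (auto dest: homeomorphism_cont1 homeomorphism_cont2)
  show "inj_on \<phi> U" by (rule inj_on_inverseI) (rule homeomorphism_apply1[OF h])
qed

lemma chart_exists:
  assumes "smooth_atlas A"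
  obtains U \<phi> where "(U, \<phi>) \<in> A" "p \<in> U"
proof -
  have "p \<in> (\<Union>(U, \<phi>)\<in>A. U)" using assms unfolding smooth_atlas_def by simp
  then show ?thesis using that by auto
qed

lemma chart_inverse [simp]:
  assumes "smooth_atlas A" "(U, \<phi>) \<in> A" "q \<in> U"
  shows "inv_into U \<phi> (\<phi> q) = q"
  using chartD(3)[OF assms(1,2)] assms(3) by simp

lemma open_chart_image:
  assumes "smooth_atlas A" "(U, \<phi>) \<in> A" "open W"
  shows "open (\<phi> ` (U \<inter> W))"
proof -
  have "openin (top_of_set U) (U \<inter> W)" using assms(3) by (simp add: openin_open_Int)
  then have "openin (top_of_set (\<phi> ` U)) (\<phi> ` (U \<inter> W))"
    using homeomorphism_imp_open_map[OF chartD(6)[OF assms(1,2)]] by blast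
  then show ?thesis using chartD(2)[OF assms(1,2)] openin_open_trans by blast
qed

lemma smooth_transition:
  assumes "smooth_atlas A" "(U, \<phi>) \<in> A" "(V, \<theta>) \<in> A"
  shows "smooth_on (\<phi> ` (U \<inter> V)) (\<theta> \<circ> inv_into U \<phi>)"
  using bspec[OF bspec[OF assms(1)[unfolded smooth_atlas_def, THEN conjunct2, THEN conjunct2]
        assms(2), simplified] assms(3)] by simp

text \<open>Inside the domain of a chart, smoothness in that chart suffices: every other coordinate
  expression differs from it by a transition map.\<close>

lemma smooth_fun_onI_chart:
  assumes A: "smooth_atlas A" "(U, \<phi>) \<in> A" and W: "open W" "W \<subseteq> U"
    and f: "smooth_on (\<phi> ` W) (f \<circ> inv_into U \<phi>)"
  shows "smooth_fun_on A W f"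
  unfolding smooth_fun_on_def
proof (intro conjI W ballI, clarify)
  fix V \<theta> assume V: "(V, \<theta>) \<in> A"
  have "smooth_on (\<theta> ` (V \<inter> W)) (\<phi> \<circ> inv_into V \<theta>)"
    by (rule smooth_on_subset[OF smooth_transition[OF A(1) V A(2)]]) (use W(2) in auto)
  moreover have "open (\<theta> ` (V \<inter> W))" by (rule open_chart_image[OF A(1) V W(1)])
  moreover have "open (\<phi> ` W)" using open_chart_image[OF A W(1)] W(2) by (simp add: Int_absorb1)
  moreover have "(\<phi> \<circ> inv_into V \<theta>) ` \<theta> ` (V \<inter> W) \<subseteq> \<phi> ` W"
    using chart_inverse[OF A(1) V] by auto
  ultimately have "smooth_on (\<theta> ` (V \<inter> W)) ((f \<circ> inv_into U \<phi>) \<circ> (\<phi> \<circ> inv_into V \<theta>))"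
    using f by (intro smooth_on_compose)
  then show "smooth_on (\<theta> ` (V \<inter> W)) (f \<circ> inv_into V \<theta>)"
    by (rule smooth_on_cong[OF _ open_chart_image[OF A(1) V W(1)]])
      (use chart_inverse[OF A(1) V] chart_inverse[OF A] W(2) in auto)
qed

lemma smooth_fun_onD:
  assumes "smooth_fun_on A W f"
  shows "open W" "(U, \<phi>) \<in> A \<Longrightarrow> smooth_on (\<phi> ` (U \<inter> W)) (f \<circ> inv_into U \<phi>)"
  using assms unfolding smooth_fun_on_def by auto

lemma smooth_fun_on_subset:
  "smooth_fun_on A W f \<Longrightarrow> V \<subseteq> W \<Longrightarrow> open V \<Longrightarrow> smooth_fun_on A V f"
  unfolding smooth_fun_on_def by (fastforce intro: smooth_on_subset)

lemma smooth_fun_on_cong: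
  assumes "smooth_atlas A" "smooth_fun_on A W f" "\<And>q. q \<in> W \<Longrightarrow> f q = g q"
  shows "smooth_fun_on A W g"
  unfolding smooth_fun_on_def
proof (intro conjI ballI; clarify?)
  show W: "open W" using assms(2) by (rule smooth_fun_onD)
  fix U \<phi> assume U: "(U, \<phi>) \<in> A"
  show "smooth_on (\<phi> ` (U \<inter> W)) (g \<circ> inv_into U \<phi>)"
    by (rule smooth_on_cong[OF smooth_fun_onD(2)[OF assms(2) U] open_chart_image[OF assms(1) U W]])
      (use assms(3) chart_inverse[OF assms(1) U] in auto)
qed

lemma smooth_fun_on_const:
  assumes "smooth_atlas A" "open W"
  shows "smooth_fun_on A W (\<lambda>q. c)"
  unfolding smooth_fun_on_def o_def
  using assms by (auto intro!: smooth_on_const open_chart_image)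

lemma smooth_fun_on_add:
  assumes "smooth_atlas A" "smooth_fun_on A W f" "smooth_fun_on A W g"
  shows "smooth_fun_on A W (\<lambda>q. f q + g q)"
  unfolding smooth_fun_on_def o_def
  using assms smooth_fun_onD[OF assms(2)] smooth_fun_onD[OF assms(3)] open_chart_image[OF assms(1)]
  by (auto intro!: smooth_on_add simp: o_def)

lemma smooth_fun_on_mult:
  assumes "smooth_atlas A" "smooth_fun_on A W f" "smooth_fun_on A W g"
  shows "smooth_fun_on A W (\<lambda>q. f q * g q)"
  unfolding smooth_fun_on_def o_def
  using assms smooth_fun_onD[OF assms(2)] smooth_fun_onD[OF assms(3)] open_chart_image[OF assms(1)]
  by (auto intro!: smooth_on_mult simp: o_def)

lemma smooth_atI: "smooth_fun_on A W f \<Longrightarrow> p \<in> W \<Longrightarrow> smooth_at A p f"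
  unfolding smooth_at_def by blast

lemma smooth_at_common_nbhd:
  assumes "smooth_at A p f" "smooth_at A p g"
  obtains W where "p \<in> W" "smooth_fun_on A W f" "smooth_fun_on A W g"
proof -
  obtain V1 V2 where "p \<in> V1" "p \<in> V2" "smooth_fun_on A V1 f" "smooth_fun_on A V2 g"
    using assms unfolding smooth_at_def by blast
  then show ?thesis
    by (intro that[of "V1 \<inter> V2"]) (auto intro: smooth_fun_on_subset dest: smooth_fun_onD(1))
qed

lemma smooth_at_const: "smooth_atlas A \<Longrightarrow> smooth_at A p (\<lambda>q. c)"
  using smooth_atI[OF smooth_fun_on_const[of A UNIV]] by auto

lemma smooth_at_add:
  assumes "smooth_atlas A" "smooth_at A p f" "smooth_at A p g"
  shows "smooth_at A p (\<lambda>q. f q + g q)"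
proof -
  obtain W where "p \<in> W" "smooth_fun_on A W f" "smooth_fun_on A W g"
    using smooth_at_common_nbhd[OF assms(2,3)] .
  then show ?thesis by (intro smooth_atI[OF smooth_fun_on_add[OF assms(1)]])
qed

lemma smooth_at_mult:
  assumes "smooth_atlas A" "smooth_at A p f" "smooth_at A p g"
  shows "smooth_at A p (\<lambda>q. f q * g q)"
proof -
  obtain W where "p \<in> W" "smooth_fun_on A W f" "smooth_fun_on A W g"
    using smooth_at_common_nbhd[OF assms(2,3)] .
  then show ?thesis by (intro smooth_atI[OF smooth_fun_on_mult[OF assms(1)]])
qed

lemma smooth_at_sum:
  assumes "smooth_atlas A" "finite I" "\<And>i. i \<in> I \<Longrightarrow> smooth_at A p (f i)"
  shows "smooth_at A p (\<lambda>q. \<Sum>i\<in>I. f i q)"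
  using assms(2,3) 
  by (induction I rule: finite_induct) (auto simp: smooth_at_const smooth_at_add assms(1))

lemma smooth_at_cong:
  assumes "smooth_atlas A" "smooth_at A p f" "open W" "p \<in> W" "\<And>q. q \<in> W \<Longrightarrow> f q = g q"
  shows "smooth_at A p g"
proof -
  obtain V where V: "p \<in> V" "smooth_fun_on A V f" using assms(2) unfolding smooth_at_def by blast
  then have "smooth_fun_on A (V \<inter> W) f"
    using assms(3) by (auto intro!: smooth_fun_on_subset[OF V(2)] dest: smooth_fun_onD(1))
  then have "smooth_fun_on A (V \<inter> W) g"
    using assms(1,5) by (auto intro: smooth_fun_on_cong)
  then show ?thesis by (rule smooth_atI) (use V assms(4) in auto)
qed

section \<open>Tangent vectors in charts\<close>

text \<open>The tangent vector with components \<open>w\<close> in the chart \<open>c\<close>. The point is the last of the geometric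
  arguments, so that for constant \<open>w\<close> this is a coordinate field on the domain of the chart. The value
  zero on functions that are not smooth at \<open>p\<close> matches the convention for velocities.\<close>

definition coord_vector ::
    "('a::topological_space, 'e::finite_dim_inner) chart set \<Rightarrow> ('a, 'e) chart \<Rightarrow> 'e \<Rightarrow> 'a \<Rightarrow> 'a tvec"
  where
  "coord_vector A c w p f = (if smooth_at A p f
     then frechet_derivative (f \<circ> inv_into (fst c) (snd c)) (at (snd c p)) w else 0)"

lemma coord_vector_smooth:
  "smooth_at A p f \<Longrightarrow>
    coord_vector A (U, \<phi>) w p f = frechet_derivative (f \<circ> inv_into U \<phi>) (at (\<phi> p)) w"
  by (simp add: coord_vector_def)

lemma chart_has_derivative:
  assumes "(U, \<phi>) \<in> A" "p \<in> U" "smooth_at A p f"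
  shows "((f \<circ> inv_into U \<phi>) has_derivative frechet_derivative (f \<circ> inv_into U \<phi>) (at (\<phi> p))) (at (\<phi> p))"
proof -
  obtain W where W: "p \<in> W" "smooth_fun_on A W f" using assms(3) unfolding smooth_at_def by blast
  show ?thesis
    using smooth_fun_onD(2)[OF W(2) assms(1)] by (rule smooth_on_has_derivative) (use assms W in auto)
qed

text \<open>This is the chain rule for \<open>f \<circ> \<gamma> = (f \<circ> \<phi>\<^sup>-\<^sup>1) \<circ> (\<phi> \<circ> \<gamma>)\<close>, which holds near \<open>0\<close> only.\<close>

lemma velocity_in_chart:
  assumes A: "(U, \<phi>) \<in> A" and p: "\<gamma> 0 \<in> U" "open U" and c: "open I" "0 \<in> I" "continuous_on I \<gamma>"
    and d: "((\<phi> \<circ> \<gamma>) has_derivative (\<lambda>t. t *\<^sub>R w)) (at 0)" and inj: "inj_on \<phi> U"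
  shows "velocity A \<gamma> = coord_vector A (U, \<phi>) w (\<gamma> 0)"
proof
  fix f
  show "velocity A \<gamma> f = coord_vector A (U, \<phi>) w (\<gamma> 0) f"
  proof (cases "smooth_at A (\<gamma> 0) f")
    case True
    let ?F = "f \<circ> inv_into U \<phi>"
    let ?D = "frechet_derivative ?F (at (\<phi> (\<gamma> 0)))"
    have D: "(?F has_derivative ?D) (at (\<phi> (\<gamma> 0)))" by (rule chart_has_derivative[OF A p(1) True])
    have "((?F \<circ> (\<phi> \<circ> \<gamma>)) has_derivative (?D \<circ> (\<lambda>t. t *\<^sub>R w))) (at 0)"
      by (rule diff_chain_at[OF d]) (use D in simp)
    moreover have "open (\<gamma> -` U \<inter> I)" 
      using c(1,3) p(2) continuous_on_open_vimage by blast
    ultimately have "((\<lambda>t. f (\<gamma> t)) has_derivative (?D \<circ> (\<lambda>t. t *\<^sub>R w))) (at 0)"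
      by (rule has_derivative_transform_within_open) (use c p inj in auto)
    moreover have "?D \<circ> (\<lambda>t. t *\<^sub>R w) = (*) (?D w)"
      using has_derivative_linear[OF D] by (simp add: fun_eq_iff linear_scale mult.commute)
    ultimately have "((\<lambda>t. f (\<gamma> t)) has_derivative (*) (?D w)) (at 0)" by simp
    then have "deriv (\<lambda>t. f (\<gamma> t)) 0 = ?D w"
      by (auto intro: DERIV_imp_deriv simp: has_field_derivative_def)
    then show ?thesis using True by (simp add: velocity_def coord_vector_smooth)
  qed (simp add: velocity_def coord_vector_def)
qed

text \<open>The preimage under a chart of a straight line realises any prescribed components. The curve
  stays in the chart domain for small times, and in another chart it is a straight line followed by
  a transition map.\<close>

lemma coord_line_smooth_curve:
  fixes w :: "_::finite_dim_inner"
  assumes A: "smooth_atlas A" "(U, \<phi>) \<in> A" and p: "p \<in> U"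
  defines "\<gamma> \<equiv> \<lambda>t. inv_into U \<phi> (\<phi> p + t *\<^sub>R w)"
  shows "smooth_curve A \<gamma>" "\<gamma> 0 = p" "velocity A \<gamma> = coord_vector A (U, \<phi>) w p"
proof -
  let ?l = "\<lambda>t::real. \<phi> p + t *\<^sub>R w"
  have bl: "bounded_linear (\<lambda>t::real. t *\<^sub>R w)" by (rule bounded_linear_scaleR_left)
  have cont: "continuous_on UNIV ?l" by (intro continuous_intros)
  then have "open (?l -` (\<phi> ` U))" using chartD(2)[OF A] continuous_on_open_vimage[of UNIV ?l] by auto
  moreover have "0 \<in> ?l -` (\<phi> ` U)" using p by auto
  ultimately obtain \<epsilon> where e: "\<epsilon> > 0" "ball 0 \<epsilon> \<subseteq> ?l -` (\<phi> ` U)" using openE by blast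
  define I where "I = {-\<epsilon><..<\<epsilon>}"
  have lI: "?l t \<in> \<phi> ` U" if "t \<in> I" for t using e that by (auto simp: I_def dist_real_def subset_iff)
  have cI: "continuous_on I \<gamma>"
    unfolding \<gamma>_def
    using continuous_on_compose2[OF chartD(5)[OF A] continuous_on_subset[OF cont]] lI by auto
  have oI: "open I" "0 \<in> I" using e(1) by (auto simp: I_def)
  show g0: "\<gamma> 0 = p" using p A by (simp add: \<gamma>_def)
  have "smooth_on {t \<in> I. \<gamma> t \<in> V} (\<theta> \<circ> \<gamma>)" if V: "(V, \<theta>) \<in> A" for V \<theta>
  proof -
    have S: "{t \<in> I. \<gamma> t \<in> V} = \<gamma> -` V \<inter> I" by auto
    have oS: "open {t \<in> I. \<gamma> t \<in> V}" unfolding S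
      using oI(1) cI chartD(1)[OF A(1) V] continuous_on_open_vimage by blast
    have "smooth_on {t \<in> I. \<gamma> t \<in> V} ?l"
      by (intro smooth_on_add smooth_on_const smooth_on_bounded_linear bl oS)
    moreover have "?l ` {t \<in> I. \<gamma> t \<in> V} \<subseteq> \<phi> ` (U \<inter> V)"
    proof clarify
      fix t assume t: "t \<in> I" "\<gamma> t \<in> V"
      obtain q where "q \<in> U" "?l t = \<phi> q" using lI[OF t(1)] by auto
      then show "?l t \<in> \<phi> ` (U \<inter> V)" using t(2) A by (auto simp: \<gamma>_def)
    qed
    ultimately have "smooth_on {t \<in> I. \<gamma> t \<in> V} ((\<theta> \<circ> inv_into U \<phi>) \<circ> ?l)"
      using smooth_transition[OF A V] oS open_chart_image[OF A chartD(1)[OF A(1) V]]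
      by (intro smooth_on_compose)
    then show ?thesis by (simp add: o_def \<gamma>_def)
  qed
  then show "smooth_curve A \<gamma>"
    unfolding smooth_curve_def using e(1) cI by (auto simp: I_def intro!: exI[of _ \<epsilon>])
  have "(?l has_derivative (\<lambda>t. t *\<^sub>R w)) (at 0)"
    by (rule derivative_eq_intros | simp)+
  then have "((\<phi> \<circ> \<gamma>) has_derivative (\<lambda>t. t *\<^sub>R w)) (at 0)"
    by (rule has_derivative_transform_within_open[OF _ oI])
      (use lI in \<open>auto simp: \<gamma>_def f_inv_into_f\<close>)
  from velocity_in_chart[OF A(2) _ chartD(1)[OF A] oI cI this chartD(3)[OF A]]
  show "velocity A \<gamma> = coord_vector A (U, \<phi>) w p" using g0 p by simp
qed

text \<open>This turns the definition by curves, which does not show the linear structure, into a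
  parametrisation by the model space. Linearity, locality and the sum and product rules below are read
  off from it.\<close>

lemma tangent_space_in_chart:
  assumes A: "smooth_atlas A" "(U, \<phi>) \<in> A" and p: "p \<in> U"
  shows "tangent_space A p = range (\<lambda>w. coord_vector A (U, \<phi>) w p)"
proof
  show "range (\<lambda>w. coord_vector A (U, \<phi>) w p) \<subseteq> tangent_space A p"
  proof clarify
    fix w
    show "coord_vector A (U, \<phi>) w p \<in> tangent_space A p"
      unfolding tangent_space_def coord_line_smooth_curve(3)[OF assms, symmetric]
      using coord_line_smooth_curve(1,2)[OF assms] by blast
  qed
  show "tangent_space A p \<subseteq> range (\<lambda>w. coord_vector A (U, \<phi>) w p)"
  proof
    fix v assume "v \<in> tangent_space A p"
    then obtain \<gamma> where g: "v = velocity A \<gamma>" "smooth_curve A \<gamma>" "\<gamma> 0 = p"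
      unfolding tangent_space_def by blast
    then obtain \<epsilon> where e: "\<epsilon> > 0" "continuous_on {-\<epsilon><..<\<epsilon>} \<gamma>"
      "smooth_on {t\<in>{-\<epsilon><..<\<epsilon>}. \<gamma> t \<in> U} (\<phi> \<circ> \<gamma>)"
      using A(2) unfolding smooth_curve_def by blast
    let ?D = "frechet_derivative (\<phi> \<circ> \<gamma>) (at 0)"
    have D: "((\<phi> \<circ> \<gamma>) has_derivative ?D) (at 0)"
      by (rule smooth_on_has_derivative[OF e(3)]) (use e p g in auto)
    then have "?D t = t *\<^sub>R ?D 1" for t
      using linear_scale[OF has_derivative_linear[OF D], of t 1] by simp
    then have "?D = (\<lambda>t. t *\<^sub>R ?D 1)" by blast
    with D have "((\<phi> \<circ> \<gamma>) has_derivative (\<lambda>t. t *\<^sub>R ?D 1)) (at 0)" by simp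
    from velocity_in_chart[OF A(2) _ chartD(1)[OF A] _ _ e(2) this chartD(3)[OF A]]
    have "v = coord_vector A (U, \<phi>) (?D 1) p" using g p e(1) by auto
    then show "v \<in> range (\<lambda>w. coord_vector A (U, \<phi>) w p)" by blast
  qed
qed

lemma tangent_vector_cases:
  assumes "smooth_atlas A" "(U, \<phi>) \<in> A" "p \<in> U" "v \<in> tangent_space A p"
  obtains w where "v = coord_vector A (U, \<phi>) w p"
  using assms(4) unfolding tangent_space_in_chart[OF assms(1-3)] by blast

lemma coord_vector_linear:
  assumes A: "(U, \<phi>) \<in> A" and p: "p \<in> U"
  shows "coord_vector A (U, \<phi>) (a *\<^sub>R u + b *\<^sub>R w) p
    = (\<lambda>f. a * coord_vector A (U, \<phi>) u p f + b * coord_vector A (U, \<phi>) w p f)"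
proof
  fix f
  show "coord_vector A (U, \<phi>) (a *\<^sub>R u + b *\<^sub>R w) p f
    = a * coord_vector A (U, \<phi>) u p f + b * coord_vector A (U, \<phi>) w p f"
  proof (cases "smooth_at A p f")
    case True
    then show ?thesis
      using has_derivative_linear[OF chart_has_derivative[OF A p True]]
      by (simp add: coord_vector_smooth linear_add linear_scale)
  qed (simp add: coord_vector_def)
qed

lemma tangent_space_lincomb:
  assumes A: "smooth_atlas A" and u: "u \<in> tangent_space A p" and v: "v \<in> tangent_space A p"
  shows "(\<lambda>f. a * u f + b * v f) \<in> tangent_space A p"
proof -
  obtain U \<phi> where U: "(U, \<phi>) \<in> A" "p \<in> U" using chart_exists[OF A] .
  obtain x where x: "u = coord_vector A (U, \<phi>) x p" using tangent_vector_cases[OF A U u] .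
  obtain y where y: "v = coord_vector A (U, \<phi>) y p" using tangent_vector_cases[OF A U v] .
  show ?thesis
    unfolding x y coord_vector_linear[OF U, symmetric] tangent_space_in_chart[OF A U] by (rule rangeI)
qed

lemma tangent_space_zero:
  assumes "smooth_atlas A" shows "(\<lambda>f. 0) \<in> tangent_space A p"
proof -
  obtain U \<phi> where U: "(U, \<phi>) \<in> A" "p \<in> U" using chart_exists[OF assms] .
  have "coord_vector A (U, \<phi>) 0 p \<in> tangent_space A p"
    unfolding tangent_space_in_chart[OF assms U] by (rule rangeI)
  from tangent_space_lincomb[OF assms this this, of 0 0] show ?thesis by simp
qed

lemma tangent_vector_local:
  assumes A: "smooth_atlas A" and v: "v \<in> tangent_space A p"
    and W: "open W" "p \<in> W" "\<And>q. q \<in> W \<Longrightarrow> f q = g q"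
  shows "v f = v g"
proof -
  have s: "smooth_at A p f \<longleftrightarrow> smooth_at A p g"
    using smooth_at_cong[OF A _ W(1,2), of f g] smooth_at_cong[OF A _ W(1,2), of g f] W(3) by auto
  obtain U \<phi> where U: "(U, \<phi>) \<in> A" "p \<in> U" using chart_exists[OF A] .
  obtain w where w: "v = coord_vector A (U, \<phi>) w p" using tangent_vector_cases[OF A U v] .
  have "frechet_derivative (f \<circ> inv_into U \<phi>) (at (\<phi> p)) = frechet_derivative (g \<circ> inv_into U \<phi>) (at (\<phi> p))"
    by (rule frechet_derivative_cong_open[OF open_chart_image[OF A U(1) W(1)]])
      (use U W chart_inverse[OF A U(1)] in auto)
  then show ?thesis by (simp add: w coord_vector_def s)
qed

lemma tangent_vector_const:
  assumes A: "smooth_atlas A" and v: "v \<in> tangent_space A p"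
  shows "v (\<lambda>q. c) = 0"
proof -
  obtain \<gamma> where "v = velocity A \<gamma>" using v unfolding tangent_space_def by blast
  then show ?thesis by (simp add: velocity_def)
qed

lemma tangent_vector_mult:
  assumes A: "smooth_atlas A" and v: "v \<in> tangent_space A p"
    and f: "smooth_at A p f" "smooth_at A p g"
  shows "v (\<lambda>q. f q * g q) = v f * g p + f p * v g"
proof -
  obtain U \<phi> where U: "(U, \<phi>) \<in> A" "p \<in> U" using chart_exists[OF A] .
  obtain w where w: "v = coord_vector A (U, \<phi>) w p" using tangent_vector_cases[OF A U v] .
  let ?F = "f \<circ> inv_into U \<phi>" and ?G = "g \<circ> inv_into U \<phi>"
  have "((\<lambda>x. ?F x * ?G x) has_derivative (\<lambda>h. ?F (\<phi> p) * frechet_derivative ?G (at (\<phi> p)) h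
      + frechet_derivative ?F (at (\<phi> p)) h * ?G (\<phi> p))) (at (\<phi> p))"
    by (intro has_derivative_mult chart_has_derivative[OF U] f)
  from frechet_derivative_at[OF this]
  have "frechet_derivative ((\<lambda>q. f q * g q) \<circ> inv_into U \<phi>) (at (\<phi> p)) w
    = ?F (\<phi> p) * frechet_derivative ?G (at (\<phi> p)) w + frechet_derivative ?F (at (\<phi> p)) w * ?G (\<phi> p)"
    by (simp add: o_def fun_eq_iff)
  then show ?thesis
    using f smooth_at_mult[OF A f] chart_inverse[OF A U] by (simp add: w coord_vector_smooth)
qed

lemma tangent_vector_add:
  assumes A: "smooth_atlas A" and v: "v \<in> tangent_space A p"
    and f: "smooth_at A p f" "smooth_at A p g"
  shows "v (\<lambda>q. f q + g q) = v f + v g"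
proof -
  obtain U \<phi> where U: "(U, \<phi>) \<in> A" "p \<in> U" using chart_exists[OF A] .
  obtain w where w: "v = coord_vector A (U, \<phi>) w p" using tangent_vector_cases[OF A U v] .
  let ?F = "f \<circ> inv_into U \<phi>" and ?G = "g \<circ> inv_into U \<phi>"
  have "((\<lambda>x. ?F x + ?G x) has_derivative (\<lambda>h. frechet_derivative ?F (at (\<phi> p)) h
      + frechet_derivative ?G (at (\<phi> p)) h)) (at (\<phi> p))"
    by (intro has_derivative_add chart_has_derivative[OF U] f)
  from frechet_derivative_at[OF this]
  have "frechet_derivative ((\<lambda>q. f q + g q) \<circ> inv_into U \<phi>) (at (\<phi> p)) w
    = frechet_derivative ?F (at (\<phi> p)) w + frechet_derivative ?G (at (\<phi> p)) w"
    by (simp add: o_def fun_eq_iff)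
  then show ?thesis
    using f smooth_at_add[OF A f] by (simp add: w coord_vector_smooth)
qed

lemma tangent_vector_sum:
  assumes A: "smooth_atlas A" and v: "v \<in> tangent_space A p"
    and "finite I" "\<And>i. i \<in> I \<Longrightarrow> smooth_at A p (f i)"
  shows "v (\<lambda>q. \<Sum>i\<in>I. f i q) = (\<Sum>i\<in>I. v (f i))"
  using assms(3,4)
proof (induction I rule: finite_induct)
  case empty
  then show ?case by (simp add: tangent_vector_const[OF A v])
next
  case (insert i I)
  then show ?case by (simp add: tangent_vector_add[OF A v] smooth_at_sum[OF A])
qed

lemma smooth_fun_on_chart_coord:
  assumes A: "smooth_atlas A" "(U, \<phi>) \<in> A"
  shows "smooth_fun_on A U (\<lambda>q. \<phi> q \<bullet> b)"
proof (rule smooth_fun_onI_chart[OF A chartD(1)[OF A] order_refl])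
  have "smooth_on (\<phi> ` U) (\<lambda>x. x \<bullet> b)"
    by (intro smooth_on_bounded_linear bounded_linear_inner_left chartD(2)[OF A])
  then show "smooth_on (\<phi> ` U) ((\<lambda>q. \<phi> q \<bullet> b) \<circ> inv_into U \<phi>)"
    by (rule smooth_on_cong[OF _ chartD(2)[OF A]]) (use A in auto)
qed

lemma coord_vector_chart_coord:
  assumes A: "smooth_atlas A" "(U, \<phi>) \<in> A" and p: "p \<in> U"
  shows "coord_vector A (U, \<phi>) w p (\<lambda>q. \<phi> q \<bullet> b) = w \<bullet> b"
proof -
  have "((\<lambda>x. x \<bullet> b) has_derivative (\<lambda>x. x \<bullet> b)) (at (\<phi> p))"
    by (intro bounded_linear_imp_has_derivative bounded_linear_inner_left)
  then have "(((\<lambda>q. \<phi> q \<bullet> b) \<circ> inv_into U \<phi>) has_derivative (\<lambda>x. x \<bullet> b)) (at (\<phi> p))"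
    by (rule has_derivative_transform_within_open[OF _ chartD(2)[OF A]]) (use A p in auto)
  from frechet_derivative_at[OF this, symmetric] show ?thesis
    unfolding coord_vector_smooth[OF smooth_atI[OF smooth_fun_on_chart_coord[OF A] p]]
    by (rule fun_cong)
qed

text \<open>The expansion \<open>v = \<Sum> v(x\<^sup>b) \<partial>\<^sub>b\<close> in coordinate vectors. A Parseval frame serves as the basis,
  and the coordinates are the inner products with its members.\<close>

lemma tangent_vector_expansion:
  assumes A: "smooth_atlas A" "(U, \<phi>) \<in> A" and p: "p \<in> U" and v: "v \<in> tangent_space A p"
  shows "v = (\<lambda>f. \<Sum>b\<in>frame. v (\<lambda>q. \<phi> q \<bullet> b) * coord_vector A (U, \<phi>) b p f)"
proof
  fix f
  obtain w where w: "v = coord_vector A (U, \<phi>) w p" using tangent_vector_cases[OF A p v] .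
  have c: "v (\<lambda>q. \<phi> q \<bullet> b) = w \<bullet> b" for b unfolding w by (rule coord_vector_chart_coord[OF A p])
  show "v f = (\<Sum>b\<in>frame. v (\<lambda>q. \<phi> q \<bullet> b) * coord_vector A (U, \<phi>) b p f)"
    unfolding c
  proof (cases "smooth_at A p f")
    case True
    then show "v f = (\<Sum>b\<in>frame. (w \<bullet> b) * coord_vector A (U, \<phi>) b p f)"
      using linear_frame_expansion[OF has_derivative_linear[OF chart_has_derivative[OF A(2) p True]], of w]
      by (simp add: w coord_vector_smooth)
  qed (simp add: w coord_vector_def)
qed

lemma vector_field_onD:
  assumes "vector_field_on A W X"
  shows "open W" "p \<in> W \<Longrightarrow> X p \<in> tangent_space A p"
    "V \<subseteq> W \<Longrightarrow> smooth_fun_on A V f \<Longrightarrow> smooth_fun_on A V (\<lambda>p. X p f)"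
  using assms unfolding vector_field_on_def by auto

lemma vector_field_smooth_at:
  assumes "vector_field A X" "smooth_at A p f"
  shows "smooth_at A p (\<lambda>q. X q f)"
  using assms vector_field_onD(3)[OF assms(1)] unfolding smooth_at_def by blast

lemma vector_field_on_coord_vector:
  assumes A: "smooth_atlas A" "(U, \<phi>) \<in> A"
  shows "vector_field_on A U (coord_vector A (U, \<phi>) w)"
  unfolding vector_field_on_def
proof (intro conjI allI impI ballI chartD(1)[OF A])
  show "coord_vector A (U, \<phi>) w p \<in> tangent_space A p" if "p \<in> U" for p
    unfolding tangent_space_in_chart[OF A that] by (rule rangeI)
  fix V f assume V: "V \<subseteq> U \<and> smooth_fun_on A V f"
  then have oV: "open V" using smooth_fun_onD(1) by blast
  have UV: "U \<inter> V = V" using V by auto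
  have "smooth_on (\<phi> ` V) (f \<circ> inv_into U \<phi>)" using V smooth_fun_onD(2)[OF _ A(2)] UV by metis
  then have "smooth_on (\<phi> ` V) (\<lambda>x. frechet_derivative (f \<circ> inv_into U \<phi>) (at x) w)"
    by (rule smooth_on_directional_derivative)
  moreover have "open (\<phi> ` V)" using open_chart_image[OF A oV] UV by simp
  ultimately have "smooth_on (\<phi> ` V) ((\<lambda>p. coord_vector A (U, \<phi>) w p f) \<circ> inv_into U \<phi>)"
    by (rule smooth_on_cong) (use V chart_inverse[OF A] smooth_atI in \<open>force simp: coord_vector_smooth\<close>)
  then show "smooth_fun_on A V (\<lambda>p. coord_vector A (U, \<phi>) w p f)"
    using V by (intro smooth_fun_onI_chart[OF A oV]) auto
qed

lemma vector_field_lincomb: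
  assumes A: "smooth_atlas A" and X: "vector_field A X" "vector_field A Y"
    and a: "smooth_fun_on A UNIV a" "smooth_fun_on A UNIV b"
  shows "vector_field A (\<lambda>p f. a p * X p f + b p * Y p f)"
  unfolding vector_field_on_def
proof (intro conjI allI impI ballI open_UNIV)
  show "(\<lambda>f. a p * X p f + b p * Y p f) \<in> tangent_space A p" for p
    using X by (intro tangent_space_lincomb[OF A] vector_field_onD(2)) auto
  fix V f assume V: "V \<subseteq> UNIV \<and> smooth_fun_on A V f"
  then show "smooth_fun_on A V (\<lambda>p. a p * X p f + b p * Y p f)"
    using smooth_fun_onD(1) smooth_fun_on_subset[OF a(1)] smooth_fun_on_subset[OF a(2)]
    by (intro smooth_fun_on_add smooth_fun_on_mult vector_field_onD(3)[OF X(1)] vector_field_onD(3)[OF X(2)] A)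
      auto
qed

section \<open>The product with the line\<close>

lemma line_chart_image: "map_prod id \<phi> ` (UNIV \<times> W) = UNIV \<times> \<phi> ` W"
  by (auto simp: map_prod_def image_iff)

lemma line_atlas_iff:
  "c \<in> line_atlas A \<longleftrightarrow> (\<exists>U \<phi>. (U, \<phi>) \<in> A \<and> c = (UNIV \<times> U, map_prod id \<phi>))"
proof
  assume "c \<in> line_atlas A"
  then obtain d where "d \<in> A" "c = (case d of (U, \<phi>) \<Rightarrow> (UNIV \<times> U, map_prod id \<phi>))"
    unfolding line_atlas_def by (rule imageE)
  then show "\<exists>U \<phi>. (U, \<phi>) \<in> A \<and> c = (UNIV \<times> U, map_prod id \<phi>)"
    by (intro exI[of _ "fst d"] exI[of _ "snd d"]) (simp add: case_prod_beta)
next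
  assume "\<exists>U \<phi>. (U, \<phi>) \<in> A \<and> c = (UNIV \<times> U, map_prod id \<phi>)"
  then show "c \<in> line_atlas A" unfolding line_atlas_def by (auto intro: rev_image_eqI)
qed

lemma line_chart_inverse:
  assumes "inj_on \<phi> U" "x \<in> UNIV \<times> \<phi> ` U"
  shows "inv_into (UNIV \<times> U) (map_prod id \<phi>) x = (fst x, inv_into U \<phi> (snd x))"
proof -
  have inj: "inj_on (map_prod id \<phi>) (UNIV \<times> U)"
    using assms(1) by (intro map_prod_inj_on) auto
  obtain q where q: "q \<in> U" "snd x = \<phi> q" using assms(2) by (auto simp: mem_Times_iff)
  then have "x = map_prod id \<phi> (fst x, q)" by (simp add: prod_eq_iff)
  then show ?thesis using inv_into_f_f[OF inj, of "(fst x, q)"] q assms(1) by simp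
qed

lemma line_chart_inverse_apply:
  assumes "inj_on \<phi> U" "y \<in> U"
  shows "inv_into (UNIV \<times> U) (map_prod id \<phi>) (r, \<phi> y) = (r, y)"
  using line_chart_inverse[OF assms(1), of "(r, \<phi> y)"] assms by simp

lemma smooth_on_snd:
  assumes "smooth_on T h" "open T"
  shows "smooth_on (UNIV \<times> T) (\<lambda>x. h (snd x))"
proof -
  have "smooth_on (UNIV \<times> T) (h \<circ> snd)"
    by (rule smooth_on_compose[OF assms(1)])
      (use assms(2) in \<open>auto intro: smooth_on_bounded_linear bounded_linear_snd open_Times\<close>)
  then show ?thesis by (simp add: o_def)
qed

lemma smooth_atlas_line:
  assumes A: "smooth_atlas A"
  shows "smooth_atlas (line_atlas A)"
proof -
  have chart: "open (UNIV \<times> U :: (real \<times> 'a) set) \<and> open (map_prod id \<phi> ` (UNIV \<times> U) :: (real \<times> 'b) set) \<and>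
      homeomorphism (UNIV \<times> U :: (real \<times> 'a) set) (map_prod id \<phi> ` (UNIV \<times> U)) (map_prod id \<phi>)
        (inv_into (UNIV \<times> U) (map_prod id \<phi>))"
    if U: "(U, \<phi>) \<in> A" for U \<phi>
  proof (intro conjI)
    note C = chartD[OF A U]
    let ?i = "inv_into (UNIV \<times> U) (map_prod id \<phi>) :: real \<times> 'b \<Rightarrow> real \<times> 'a"
    show "open (UNIV \<times> U :: (real \<times> 'a) set)" using C(1) by (intro open_Times) auto
    show "open (map_prod id \<phi> ` (UNIV \<times> U) :: (real \<times> 'b) set)"
      unfolding line_chart_image using C(2) by (intro open_Times) auto
    have "continuous_on (UNIV \<times> U) (\<lambda>x::real \<times> 'a. (fst x, \<phi> (snd x)))"
      by (intro continuous_intros continuous_on_compose2[OF C(4)]) auto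
    then have cont: "continuous_on (UNIV \<times> U) (map_prod id \<phi> :: real \<times> 'a \<Rightarrow> _)"
      by (simp add: map_prod_def case_prod_beta)
    have "continuous_on (UNIV \<times> \<phi> ` U) (\<lambda>x::real \<times> 'b. (fst x, inv_into U \<phi> (snd x)))"
      by (intro continuous_intros continuous_on_compose2[OF C(5)]) auto
    then have conti: "continuous_on (UNIV \<times> \<phi> ` U) ?i"
      by (rule continuous_on_eq) (simp only: line_chart_inverse[OF C(3)])
    have inj: "inj_on (map_prod id \<phi> :: real \<times> 'a \<Rightarrow> _) (UNIV \<times> U)"
      using C(3) by (intro map_prod_inj_on) auto
    show "homeomorphism (UNIV \<times> U :: (real \<times> 'a) set) (map_prod id \<phi> ` (UNIV \<times> U)) (map_prod id \<phi>) ?i"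
      by (rule homeomorphismI)
        (use cont conti inj in \<open>auto simp: line_chart_image[symmetric] f_inv_into_f inv_into_f_f
            intro: inv_into_into simp del: map_prod_simp\<close>)
  qed
  have cover: "(\<Union>(U, \<phi>)\<in>line_atlas A. U) = UNIV"
  proof -
    have "\<exists>(U, \<phi>)\<in>line_atlas A. x \<in> U" for x
    proof -
      obtain U \<phi> where "(U, \<phi>) \<in> A" "snd x \<in> U" using chart_exists[OF A] .
      then show ?thesis
        by (intro bexI[of _ "(UNIV \<times> U, map_prod id \<phi>)"]) (auto simp: line_atlas_iff mem_Times_iff)
    qed
    then show ?thesis by blast
  qed
  have trans: "smooth_on (map_prod id \<phi> ` (UNIV \<times> U \<inter> UNIV \<times> V) :: (real \<times> 'b) set)
      (map_prod id \<theta> \<circ> inv_into (UNIV \<times> U) (map_prod id \<phi>))"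
    if U: "(U, \<phi>) \<in> A" and V: "(V, \<theta>) \<in> A" for U \<phi> V \<theta>
  proof -
    have I: "map_prod id \<phi> ` (UNIV \<times> U \<inter> UNIV \<times> V) = (UNIV \<times> \<phi> ` (U \<inter> V) :: (real \<times> 'b) set)"
      by (simp add: Times_Int_Times line_chart_image)
    have o: "open (\<phi> ` (U \<inter> V))" by (rule open_chart_image[OF A U chartD(1)[OF A V]])
    then have o': "open (UNIV \<times> \<phi> ` (U \<inter> V) :: (real \<times> 'b) set)" by (intro open_Times) auto
    have "smooth_on (UNIV \<times> \<phi> ` (U \<inter> V)) (\<lambda>x::real \<times> 'b. (fst x, (\<theta> \<circ> inv_into U \<phi>) (snd x)))"
      by (intro smooth_on_Pair smooth_on_snd smooth_on_bounded_linear bounded_linear_fst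
          smooth_transition[OF A U V] o o')
    then show ?thesis unfolding I
      by (rule smooth_on_cong[OF _ o']) (use chartD(3)[OF A U] in \<open>auto simp: line_chart_inverse_apply\<close>)
  qed
  show ?thesis
    unfolding smooth_atlas_def
  proof (intro conjI cover ballI)
    fix c assume "c \<in> line_atlas A"
    then obtain U \<phi> where c: "(U, \<phi>) \<in> A" "c = (UNIV \<times> U, map_prod id \<phi>)"
      unfolding line_atlas_iff by blast
    show "case c of (U, \<phi>) \<Rightarrow> open U \<and> open (\<phi> ` U) \<and> homeomorphism U (\<phi> ` U) \<phi> (inv_into U \<phi>)"
      unfolding c(2) prod.case by (rule chart[OF c(1)])
    show "case c of (U, \<phi>) \<Rightarrow> \<forall>(V, \<theta>)\<in>line_atlas A. smooth_on (\<phi> ` (U \<inter> V)) (\<theta> \<circ> inv_into U \<phi>)"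
      unfolding c(2) prod.case
    proof
      fix d assume "d \<in> line_atlas A"
      then obtain V \<theta> where d: "(V, \<theta>) \<in> A" "d = (UNIV \<times> V, map_prod id \<theta>)"
        unfolding line_atlas_iff by blast
      show "case d of (V, \<theta>) \<Rightarrow> smooth_on (map_prod id \<phi> ` (UNIV \<times> U \<inter> V))
          (\<theta> \<circ> inv_into (UNIV \<times> U) (map_prod id \<phi>))"
        unfolding d(2) prod.case by (rule trans[OF c(1) d(1)])
    qed
  qed
qed

lemma line_chart_mem: "(U, \<phi>) \<in> A \<Longrightarrow> (UNIV \<times> U, map_prod id \<phi>) \<in> line_atlas A"
  unfolding line_atlas_iff by blast

lemma smooth_fun_on_fst:
  assumes A: "smooth_atlas A"
  shows "smooth_fun_on (line_atlas A) UNIV fst"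
  unfolding smooth_fun_on_def
proof (intro conjI open_UNIV ballI)
  fix c assume "c \<in> line_atlas A"
  then obtain U \<phi> where c: "(U, \<phi>) \<in> A" "c = (UNIV \<times> U, map_prod id \<phi>)"
    unfolding line_atlas_iff by blast
  have o: "open (UNIV \<times> \<phi> ` U :: (real \<times> _) set)" using chartD(2)[OF A c(1)] by (intro open_Times) auto
  have "smooth_on (UNIV \<times> \<phi> ` U) (fst :: real \<times> _ \<Rightarrow> real)"
    by (intro smooth_on_bounded_linear bounded_linear_fst o)
  then show "case c of (U, \<phi>) \<Rightarrow> smooth_on (\<phi> ` (U \<inter> UNIV)) (fst \<circ> inv_into U \<phi>)"
    unfolding c(2) prod.case Int_UNIV_right line_chart_image
    by (rule smooth_on_cong[OF _ o]) (use chartD(3)[OF A c(1)] in \<open>auto simp: line_chart_inverse_apply\<close>)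
qed

lemma smooth_fun_on_snd:
  assumes A: "smooth_atlas A" and h: "smooth_fun_on A W h"
  shows "smooth_fun_on (line_atlas A) (UNIV \<times> W) (h \<circ> snd)"
  unfolding smooth_fun_on_def
proof (intro conjI ballI)
  have W: "open W" by (rule smooth_fun_onD(1)[OF h])
  then show "open (UNIV \<times> W)" by (intro open_Times) auto
  fix c assume "c \<in> line_atlas A"
  then obtain U \<phi> where c: "(U, \<phi>) \<in> A" "c = (UNIV \<times> U, map_prod id \<phi>)"
    unfolding line_atlas_iff by blast
  have o: "open (\<phi> ` (U \<inter> W))" by (rule open_chart_image[OF A c(1) W])
  then have o': "open (UNIV \<times> \<phi> ` (U \<inter> W) :: (real \<times> _) set)" by (intro open_Times) auto
  have "smooth_on (UNIV \<times> \<phi> ` (U \<inter> W)) (\<lambda>x::real \<times> _. (h \<circ> inv_into U \<phi>) (snd x))"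
    by (intro smooth_on_snd smooth_fun_onD(2)[OF h c(1)] o)
  then show "case c of (U, \<phi>) \<Rightarrow> smooth_on (\<phi> ` (U \<inter> UNIV \<times> W)) (h \<circ> snd \<circ> inv_into U \<phi>)"
    unfolding c(2) prod.case Times_Int_Times Int_UNIV_left line_chart_image
    by (rule smooth_on_cong[OF _ o']) (use chartD(3)[OF A c(1)] in \<open>auto simp: line_chart_inverse_apply\<close>)
qed

lemma smooth_at_snd:
  assumes "smooth_atlas A" "smooth_at A (snd p) h"
  shows "smooth_at (line_atlas A) p (h \<circ> snd)"
proof -
  obtain W where "snd p \<in> W" "smooth_fun_on A W h" using assms(2) unfolding smooth_at_def by blast
  then show ?thesis by (intro smooth_atI[OF smooth_fun_on_snd[OF assms(1)]]) (auto simp: mem_Times_iff)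
qed

lemma smooth_at_fst: "smooth_atlas A \<Longrightarrow> smooth_at (line_atlas A) p fst"
  by (rule smooth_atI[OF smooth_fun_on_fst]) auto

lemma radial_field_in_chart:
  assumes A: "smooth_atlas A" "(U, \<phi>) \<in> A" and p: "snd p \<in> U"
  shows "radial_field A p = coord_vector (line_atlas A) (UNIV \<times> U, map_prod id \<phi>) (1, 0) p"
proof -
  let ?\<gamma> = "\<lambda>t::real. (fst p + t, snd p)"
  note L = smooth_atlas_line[OF A(1)] line_chart_mem[OF A(2)]
  have "(\<lambda>t. (fst p + t, \<phi> (snd p))) = map_prod id \<phi> \<circ> ?\<gamma>" by auto
  moreover have "((\<lambda>t. (fst p + t, \<phi> (snd p))) has_derivative (\<lambda>t. t *\<^sub>R (1, 0))) (at 0)"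
    by (auto intro!: derivative_eq_intros)
  ultimately have "((map_prod id \<phi> \<circ> ?\<gamma>) has_derivative (\<lambda>t. t *\<^sub>R (1, 0))) (at 0)" by simp
  moreover have "continuous_on UNIV ?\<gamma>" by (intro continuous_intros)
  ultimately show ?thesis
    using velocity_in_chart[OF L(2) _ chartD(1)[OF L] open_UNIV, of ?\<gamma> "(1, 0)"] p chartD(3)[OF L]
    by (simp add: radial_field_def mem_Times_iff)
qed

text \<open>In a product chart the radial field differentiates in the constant direction \<open>(1, 0)\<close>, and a
  directional derivative of a smooth map is smooth.\<close>

lemma vector_field_radial:
  assumes A: "smooth_atlas A"
  shows "vector_field (line_atlas A) (radial_field A)"
  unfolding vector_field_on_def
proof (intro conjI allI impI ballI open_UNIV)
  note L = smooth_atlas_line[OF A]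
  show "radial_field A p \<in> tangent_space (line_atlas A) p" for p
  proof -
    obtain U \<phi> where U: "(U, \<phi>) \<in> A" "snd p \<in> U" using chart_exists[OF A] .
    show ?thesis
      unfolding radial_field_in_chart[OF A U]
      using tangent_space_in_chart[OF L line_chart_mem[OF U(1)]] U(2) by (simp add: mem_Times_iff)
  qed
  fix V f assume V: "V \<subseteq> UNIV \<and> smooth_fun_on (line_atlas A) V f"
  then have oV: "open V" using smooth_fun_onD(1) by blast
  show "smooth_fun_on (line_atlas A) V (\<lambda>p. radial_field A p f)"
    unfolding smooth_fun_on_def
  proof (intro conjI ballI oV)
    fix c assume "c \<in> line_atlas A"
    then obtain U \<phi> where c: "(U, \<phi>) \<in> A" "c = (UNIV \<times> U, map_prod id \<phi>)"
      unfolding line_atlas_iff by blast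
    define \<Phi> where "\<Phi> = (map_prod id \<phi> :: real \<times> _ \<Rightarrow> _)"
    define UU where "UU = (UNIV :: real set) \<times> U"
    have cL: "(UU, \<Phi>) \<in> line_atlas A" using line_chart_mem[OF c(1)] by (simp add: \<Phi>_def UU_def)
    have "smooth_on (\<Phi> ` (UU \<inter> V)) (\<lambda>x. frechet_derivative (f \<circ> inv_into UU \<Phi>) (at x) (1, 0))"
      using V smooth_fun_onD(2)[OF _ cL] by (intro smooth_on_directional_derivative) blast
    then have "smooth_on (\<Phi> ` (UU \<inter> V)) ((\<lambda>p. radial_field A p f) \<circ> inv_into UU \<Phi>)"
    proof (rule smooth_on_cong[OF _ open_chart_image[OF L cL oV]])
      fix x assume "x \<in> \<Phi> ` (UU \<inter> V)"
      then obtain q where q: "x = \<Phi> q" "q \<in> UU" "q \<in> V" by blast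
      have "smooth_at (line_atlas A) q f" using V q(3) by (intro smooth_atI[of _ V]) auto
      then have "radial_field A q f = frechet_derivative (f \<circ> inv_into UU \<Phi>) (at (\<Phi> q)) (1, 0)"
        using radial_field_in_chart[OF A c(1), of q] q(2)
        by (auto simp: UU_def \<Phi>_def coord_vector_smooth)
      then show "frechet_derivative (f \<circ> inv_into UU \<Phi>) (at x) (1, 0) =
          ((\<lambda>p. radial_field A p f) \<circ> inv_into UU \<Phi>) x"
        using chart_inverse[OF L cL q(2)] by (simp add: q(1))
    qed
    then show "case c of (U, \<phi>) \<Rightarrow> smooth_on (\<phi> ` (U \<inter> V)) ((\<lambda>p. radial_field A p f) \<circ> inv_into U \<phi>)"
      unfolding c(2) prod.case \<Phi>_def UU_def .
  qed
qed

lemma radial_field_fst [simp]: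
  assumes "smooth_atlas A" shows "radial_field A p fst = 1"
proof -
  have "((\<lambda>t. fst p + t) has_real_derivative 1) (at 0)" by (auto intro!: derivative_eq_intros)
  then show ?thesis
    using smooth_at_fst[OF assms] by (simp add: radial_field_def velocity_def DERIV_imp_deriv)
qed

text \<open>The convention that velocities vanish on functions that are not smooth makes this an identity of
  functions of \<open>p\<close> on the whole manifold, which vector fields may differentiate.\<close>

lemma radial_field_snd [simp]: "radial_field A p (h \<circ> snd) = 0"
  by (simp add: radial_field_def velocity_def)

lemma radial_field_eq_partial_r:
  assumes "smooth_at (line_atlas A) p f"
  shows "radial_field A p f = partial_r f p"
proof -
  have "((\<lambda>r. f (r, snd p)) has_real_derivative D) (at (fst p)) \<longleftrightarrow>
      ((\<lambda>t. f (fst p + t, snd p)) has_real_derivative D) (at 0)" for D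
    using DERIV_shift[of "\<lambda>r. f (r, snd p)" D 0 "fst p"] by (simp add: add.commute)
  then show ?thesis
    using assms by (simp add: radial_field_def velocity_def partial_r_def deriv_def)
qed

text \<open>The differential of the projection sends the velocity of \<open>\<gamma>\<close> to the velocity of the projected
  curve.\<close>

lemma differential_snd_tangent:
  assumes A: "smooth_atlas A" and v: "v \<in> tangent_space (line_atlas A) p"
  shows "differential A snd p v \<in> tangent_space A (snd p)"
proof -
  obtain \<gamma> where g: "v = velocity (line_atlas A) \<gamma>" "smooth_curve (line_atlas A) \<gamma>" "\<gamma> 0 = p"
    using v unfolding tangent_space_def by blast
  obtain \<epsilon> where e: "\<epsilon> > 0" "continuous_on {-\<epsilon><..<\<epsilon>} \<gamma>"
    "\<And>U \<phi>. (U, \<phi>) \<in> line_atlas A \<Longrightarrow> smooth_on {t\<in>{-\<epsilon><..<\<epsilon>}. \<gamma> t \<in> U} (\<phi> \<circ> \<gamma>)"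
    using g(2) unfolding smooth_curve_def by blast
  have c: "continuous_on {-\<epsilon><..<\<epsilon>} (\<lambda>t. snd (\<gamma> t))" by (intro continuous_on_snd e(2))
  have "smooth_on {t\<in>{-\<epsilon><..<\<epsilon>}. snd (\<gamma> t) \<in> U} (\<phi> \<circ> (\<lambda>t. snd (\<gamma> t)))"
    if U: "(U, \<phi>) \<in> A" for U \<phi>
  proof -
    have S: "{t\<in>{-\<epsilon><..<\<epsilon>}. snd (\<gamma> t) \<in> U} = (\<lambda>t. snd (\<gamma> t)) -` U \<inter> {-\<epsilon><..<\<epsilon>}" by auto
    have oS: "open {t\<in>{-\<epsilon><..<\<epsilon>}. snd (\<gamma> t) \<in> U}"
      unfolding S using c chartD(1)[OF A U] continuous_on_open_vimage[OF open_greaterThanLessThan] by blast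
    have "smooth_on {t\<in>{-\<epsilon><..<\<epsilon>}. snd (\<gamma> t) \<in> U} (map_prod id \<phi> \<circ> \<gamma>)"
      using e(3)[OF line_chart_mem[OF U]] by (simp add: mem_Times_iff)
    then have "smooth_on {t\<in>{-\<epsilon><..<\<epsilon>}. snd (\<gamma> t) \<in> U} (snd \<circ> (map_prod id \<phi> \<circ> \<gamma>))"
      by (rule smooth_on_compose[OF smooth_on_bounded_linear[OF bounded_linear_snd open_UNIV]])
        (use oS in auto)
    then show ?thesis by (simp add: o_def)
  qed
  then have "smooth_curve A (\<lambda>t. snd (\<gamma> t))"
    unfolding smooth_curve_def using e(1) c by blast
  moreover have "differential A snd p v = velocity A (\<lambda>t. snd (\<gamma> t))"
    using smooth_at_snd[OF A, of p] g(3) by (auto simp: differential_def velocity_def g(1) fun_eq_iff o_def)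
  ultimately show ?thesis
    unfolding tangent_space_def using g(3) by blast
qed

lemma differential_snd_apply:
  "smooth_at A (snd p) h \<Longrightarrow> differential A snd p v h = v (h \<circ> snd)"
  by (simp add: differential_def)

lemma differential_snd_lincomb:
  "differential A snd p (\<lambda>f. a * u f + b * v f)
    = (\<lambda>h. a * differential A snd p u h + b * differential A snd p v h)"
  by (auto simp: differential_def)

lemma differential_snd_radial: "differential A snd p (radial_field A p) = (\<lambda>h. 0)"
  by (auto simp: differential_def)

text \<open>Each coordinate of a product chart is a linear combination of \<open>r\<close> and of a coordinate of the
  factor, so a vector that annihilates \<open>r\<close> and projects to zero has vanishing components.\<close>

lemma line_tangent_vector_eq_zero:
  assumes A: "smooth_atlas A" and v: "v \<in> tangent_space (line_atlas A) p"
    and z: "v fst = 0" "differential A snd p v = (\<lambda>h. 0)"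
  shows "v = (\<lambda>f. 0)"
proof -
  note L = smooth_atlas_line[OF A]
  obtain U \<phi> where U: "(U, \<phi>) \<in> A" "snd p \<in> U" using chart_exists[OF A] .
  have "v (\<lambda>q. map_prod id \<phi> q \<bullet> b) = 0" for b
  proof -
    let ?h = "\<lambda>y. \<phi> y \<bullet> snd b"
    have h: "smooth_at A (snd p) ?h" by (rule smooth_atI[OF smooth_fun_on_chart_coord[OF A U(1)] U(2)])
    have c: "smooth_at (line_atlas A) p (\<lambda>q. fst b)" by (rule smooth_at_const[OF L])
    note f = smooth_at_fst[OF A, of p]
    have "(\<lambda>q. map_prod id \<phi> q \<bullet> b) = (\<lambda>q. fst q * fst b + (?h \<circ> snd) q)"
      by (auto simp: inner_prod_def)
    moreover have "v (\<lambda>q. fst q * fst b + (?h \<circ> snd) q) = v (\<lambda>q. fst q * fst b) + v (?h \<circ> snd)"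
      by (rule tangent_vector_add[OF L v smooth_at_mult[OF L f c] smooth_at_snd[OF A h]])
    moreover have "v (\<lambda>q. fst q * fst b) = 0"
      using tangent_vector_mult[OF L v f c] z(1) tangent_vector_const[OF L v] by simp
    moreover have "v (?h \<circ> snd) = 0"
      using differential_snd_apply[OF h, of v] z(2) by simp
    ultimately show ?thesis by simp
  qed
  then show ?thesis
    using tangent_vector_expansion[OF L line_chart_mem[OF U(1)] _ v] U(2)
    by (simp add: mem_Times_iff)
qed

text \<open>The chain rule \<open>v(F \<circ> r) = v(r) F'(r)\<close>. The derivative of \<open>F\<close> exists because \<open>F\<close> is the coordinate
  expression of \<open>f\<close> restricted to an \<open>r\<close>-line.\<close>

lemma tangent_vector_fst_fun:
  assumes A: "smooth_atlas A" and v: "v \<in> tangent_space (line_atlas A) p"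
    and f: "smooth_at (line_atlas A) p f" "\<And>r y. f (r, y) = F r"
  shows "v f = v fst * radial_field A p f"
proof -
  note L = smooth_atlas_line[OF A]
  obtain U \<phi> where U: "(U, \<phi>) \<in> A" "snd p \<in> U" using chart_exists[OF A] .
  define \<Phi> where "\<Phi> = (map_prod id \<phi> :: real \<times> _ \<Rightarrow> _)"
  define UU where "UU = (UNIV :: real set) \<times> U"
  have C: "(UU, \<Phi>) \<in> line_atlas A" "p \<in> UU"
    using line_chart_mem[OF U(1)] U(2) by (auto simp: \<Phi>_def UU_def mem_Times_iff)
  obtain w where w: "v = coord_vector (line_atlas A) (UU, \<Phi>) w p" using tangent_vector_cases[OF L C v] .
  let ?F = "f \<circ> inv_into UU \<Phi>"
  let ?D = "frechet_derivative ?F (at (\<Phi> p))"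
  have D: "(?F has_derivative ?D) (at (\<Phi> p))" by (rule chart_has_derivative[OF C f(1)])
  have F: "?F x = F (fst x)" if "x \<in> \<Phi> ` UU" for x
    using that chart_inverse[OF L C(1)] f(2) by (auto simp: \<Phi>_def)
  have op: "open (\<Phi> ` UU)" "\<Phi> p \<in> \<Phi> ` UU" using chartD(2)[OF L C(1)] C(2) by auto
  have img: "(x, \<phi> (snd p)) \<in> \<Phi> ` UU" for x
    using U(2) by (auto simp: \<Phi>_def UU_def image_iff intro!: bexI[of _ "(x, snd p)"])
  have "((\<lambda>r. (r, \<phi> (snd p))) has_derivative (\<lambda>s. (s, 0))) (at (fst p))"
    by (auto intro!: derivative_eq_intros)
  \<comment> \<open>Restricting the coordinate expression of \<open>f\<close> to an \<open>r\<close>-line recovers \<open>F\<close>.\<close>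
  from diff_chain_at[OF this, of ?F ?D] D
  have "((\<lambda>r. ?F (r, \<phi> (snd p))) has_derivative (\<lambda>s. ?D (s, 0))) (at (fst p))"
    by (simp add: o_def \<Phi>_def map_prod_def case_prod_beta)
  then have dF: "(F has_derivative (\<lambda>s. ?D (s, 0))) (at (fst (\<Phi> p)))"
    using F[OF img] by (simp add: \<Phi>_def)
  have "(fst has_derivative fst) (at (\<Phi> p))"
    by (intro bounded_linear_imp_has_derivative bounded_linear_fst)
  from diff_chain_at[OF this dF]
  have "((F \<circ> fst) has_derivative ((\<lambda>s. ?D (s, 0)) \<circ> fst)) (at (\<Phi> p))" .
  then have "(?F has_derivative ((\<lambda>s. ?D (s, 0)) \<circ> fst)) (at (\<Phi> p))"
    by (rule has_derivative_transform_within_open[OF _ op]) (use F in simp)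
  from frechet_derivative_at[OF this] have Dw: "?D w = ?D (fst w, 0)" by (metis comp_apply)
  have "?D (fst w *\<^sub>R (1, 0)) = fst w * ?D (1, 0)"
    using linear_scale[OF has_derivative_linear[OF D], of "fst w" "(1, 0)"] by simp
  then have "?D w = fst w * ?D (1, 0)" using Dw by simp
  moreover have "?D (1, 0) = radial_field A p f"
    using radial_field_in_chart[OF A U] f(1) by (simp add: \<Phi>_def UU_def coord_vector_smooth)
  moreover have "v fst = fst w"
  proof -
    have "(\<lambda>q. \<Phi> q \<bullet> (1, 0)) = fst" by (auto simp: \<Phi>_def inner_prod_def)
    with coord_vector_chart_coord[OF L C, of w "(1, 0)"] show ?thesis by (simp add: w inner_prod_def)
  qed
  ultimately show ?thesis using f(1) by (simp add: w coord_vector_smooth)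
qed

lemma factor_tangent_fst:
  assumes A: "smooth_atlas A" and v: "v \<in> factor_tangent_space A p"
  shows "v fst = 0"
proof -
  obtain w where w: "w \<in> tangent_space A (snd p)"
    "v = differential (line_atlas A) (Pair (fst p)) (snd p) w"
    using v unfolding factor_tangent_space_def by blast
  have "v fst = w (\<lambda>y. fst p)" using smooth_at_fst[OF A] by (simp add: w(2) differential_def o_def)
  then show ?thesis using tangent_vector_const[OF A w(1)] by simp
qed

section \<open>The twisted metric and its radial derivative\<close>

lemma riemannian_metricD:
  assumes "riemannian_metric A g" "u \<in> tangent_space A p" "v \<in> tangent_space A p"
  shows "w \<in> tangent_space A p \<Longrightarrow> g p (\<lambda>f. a * u f + b * v f) w = a * g p u w + b * g p v w"
    and "g p u v = g p v u"
    and "u \<noteq> (\<lambda>f. 0) \<Longrightarrow> g p u u > 0"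
  using assms unfolding riemannian_metric_def by blast+

lemma riemannian_metric_zero:
  assumes A: "smooth_atlas A" and g: "riemannian_metric A g" and w: "w \<in> tangent_space A p"
  shows "g p (\<lambda>f. 0) w = 0"
  using riemannian_metricD(1)[OF g tangent_space_zero[OF A] tangent_space_zero[OF A] w, of 0 0] by simp

lemma tangent_space_sum:
  assumes A: "smooth_atlas A" and "finite I" "\<And>i. i \<in> I \<Longrightarrow> u i \<in> tangent_space A p"
  shows "(\<lambda>f. \<Sum>i\<in>I. a i * u i f) \<in> tangent_space A p"
  using assms(2,3)
proof (induction I rule: finite_induct)
  case empty
  then show ?case by (simp add: tangent_space_zero[OF A])
next
  case (insert i I)
  then show ?case
    using tangent_space_lincomb[OF A, of "u i" p "\<lambda>f. \<Sum>i\<in>I. a i * u i f" "a i" 1] by simp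
qed

lemma riemannian_metric_sum:
  assumes A: "smooth_atlas A" and g: "riemannian_metric A g" and w: "w \<in> tangent_space A p"
    and "finite I" "\<And>i. i \<in> I \<Longrightarrow> u i \<in> tangent_space A p"
  shows "g p (\<lambda>f. \<Sum>i\<in>I. a i * u i f) w = (\<Sum>i\<in>I. a i * g p (u i) w)"
  using assms(4,5)
proof (induction I rule: finite_induct)
  case empty
  then show ?case by (simp add: riemannian_metric_zero[OF A g w])
next
  case (insert i I)
  then have "(\<lambda>f. \<Sum>i\<in>I. a i * u i f) \<in> tangent_space A p" by (intro tangent_space_sum A) auto
  from riemannian_metricD(1)[OF g _ this w, of "u i" "a i" 1] show ?case using insert by simp
qed

lemma riemannian_metric_sum_sum:
  assumes A: "smooth_atlas A" and g: "riemannian_metric A g"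
    and I: "finite I" "\<And>i. i \<in> I \<Longrightarrow> u i \<in> tangent_space A p"
  shows "g p (\<lambda>f. \<Sum>i\<in>I. a i * u i f) (\<lambda>f. \<Sum>j\<in>I. b j * u j f)
    = (\<Sum>i\<in>I. \<Sum>j\<in>I. a i * b j * g p (u i) (u j))"
proof -
  let ?w = "\<lambda>f. \<Sum>j\<in>I. b j * u j f"
  have w: "?w \<in> tangent_space A p" by (rule tangent_space_sum[OF A I])
  have "g p (u i) ?w = (\<Sum>j\<in>I. b j * g p (u i) (u j))" if i: "i \<in> I" for i
  proof -
    have "g p (u i) ?w = g p ?w (u i)" by (rule riemannian_metricD(2)[OF g I(2)[OF i] w])
    also have "\<dots> = (\<Sum>j\<in>I. b j * g p (u j) (u i))" by (rule riemannian_metric_sum[OF A g I(2)[OF i] I])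
    also have "\<dots> = (\<Sum>j\<in>I. b j * g p (u i) (u j))"
      using riemannian_metricD(2)[OF g I(2)[OF i] I(2)] by (intro sum.cong) auto
    finally show ?thesis .
  qed
  moreover have "g p (\<lambda>f. \<Sum>i\<in>I. a i * u i f) ?w = (\<Sum>i\<in>I. a i * g p (u i) ?w)"
    by (rule riemannian_metric_sum[OF A g w I])
  ultimately show ?thesis by (simp add: sum_distrib_left mult.assoc)
qed

text \<open>The function \<open>(\<pi>\<^sup>* g\<^sub>\<Y>)(X, Z)\<close>.\<close>

definition fibre_inner ::
    "('a::topological_space, 'e::finite_dim_inner) chart set \<Rightarrow> 'a metric \<Rightarrow>
     (real \<times> 'a \<Rightarrow> (real \<times> 'a) tvec) \<Rightarrow> (real \<times> 'a \<Rightarrow> (real \<times> 'a) tvec) \<Rightarrow> real \<times> 'a \<Rightarrow> real" where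
  "fibre_inner A gY X Z q = gY (snd q) (differential A snd q (X q)) (differential A snd q (Z q))"

lemma pulled_back_metric_in_chart:
  assumes A: "smooth_atlas A" "(U, \<phi>) \<in> A" and g: "riemannian_metric A gY" and q: "snd q \<in> U"
    and u: "u \<in> tangent_space (line_atlas A) q" and v: "v \<in> tangent_space (line_atlas A) q"
  shows "gY (snd q) (differential A snd q u) (differential A snd q v)
    = (\<Sum>b\<in>frame. \<Sum>c\<in>frame. u ((\<lambda>y. \<phi> y \<bullet> b) \<circ> snd) * v ((\<lambda>y. \<phi> y \<bullet> c) \<circ> snd)
        * gY (snd q) (coord_vector A (U, \<phi>) b (snd q)) (coord_vector A (U, \<phi>) c (snd q)))"
proof -
  have e: "differential A snd q w = (\<lambda>h. \<Sum>b\<in>frame. w ((\<lambda>y. \<phi> y \<bullet> b) \<circ> snd) * coord_vector A (U, \<phi>) b (snd q) h)"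
    if "w \<in> tangent_space (line_atlas A) q" for w
    using tangent_vector_expansion[OF A q differential_snd_tangent[OF A(1) that]]
      smooth_atI[OF smooth_fun_on_chart_coord[OF A] q]
    by (simp add: differential_snd_apply)
  have t: "coord_vector A (U, \<phi>) b (snd q) \<in> tangent_space A (snd q)" for b
    unfolding tangent_space_in_chart[OF A q] by (rule rangeI)
  show ?thesis unfolding e[OF u] e[OF v]
    by (rule riemannian_metric_sum_sum[OF A(1) g finite_frame t])
qed

text \<open>The Lie derivative of \<open>\<pi>\<^sup>* g\<^sub>\<Y>\<close> along \<open>\<partial>\<^sub>r\<close> is zero. Here \<open>u\<close> and \<open>v\<close> stand for the brackets
  \<open>[\<partial>\<^sub>r, X]\<close> and \<open>[\<partial>\<^sub>r, Z]\<close>; on functions lifted from \<open>\<Y>\<close>, which \<open>\<partial>\<^sub>r\<close> annihilates, the bracket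
  with \<open>X\<close> is \<open>f \<mapsto> \<partial>\<^sub>r (X f)\<close>, which is what the hypotheses on \<open>u\<close> and \<open>v\<close> record. In a chart
  the function is \<open>\<Sum> X\<^sup>b Z\<^sup>c G\<^sub>b\<^sub>c\<close> with \<open>G\<^sub>b\<^sub>c\<close> lifted from \<open>\<Y>\<close>, so the Leibniz rule differentiates the
  components only. The second claim has content because of the first: tangent vectors vanish by
  convention on functions that are not smooth.\<close>

lemma radial_derivative_pulled_back_metric:
  assumes A: "smooth_atlas A" and g: "riemannian_metric A gY"
    and X: "vector_field (line_atlas A) X" and Z: "vector_field (line_atlas A) Z"
    and u: "u \<in> tangent_space (line_atlas A) p"
      "\<And>h. smooth_at A (snd p) h \<Longrightarrow> u (h \<circ> snd) = radial_field A p (\<lambda>q. X q (h \<circ> snd))"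
    and v: "v \<in> tangent_space (line_atlas A) p"
      "\<And>h. smooth_at A (snd p) h \<Longrightarrow> v (h \<circ> snd) = radial_field A p (\<lambda>q. Z q (h \<circ> snd))"
  shows "smooth_at (line_atlas A) p (fibre_inner A gY X Z)"
    and "radial_field A p (fibre_inner A gY X Z)
      = gY (snd p) (differential A snd p u) (differential A snd p (Z p))
      + gY (snd p) (differential A snd p (X p)) (differential A snd p v)"
proof -
  note L = smooth_atlas_line[OF A]
  let ?R = "radial_field A p"
  obtain U \<phi> where U: "(U, \<phi>) \<in> A" "snd p \<in> U" using chart_exists[OF A] .
  define x where "x b = (\<lambda>y. \<phi> y \<bullet> b) \<circ> (snd :: real \<times> _ \<Rightarrow> _)" for b
  define G where "G b c = (\<lambda>y. gY y (coord_vector A (U, \<phi>) b y) (coord_vector A (U, \<phi>) c y))" for b c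
  define T where "T b c = (\<lambda>q. X q (x b) * Z q (x c) * (G b c \<circ> snd) q)" for b c
  define W where "W = (UNIV :: real set) \<times> U"
  have W: "open W" "p \<in> W"
    using chartD(1)[OF A U(1)] U(2) by (auto simp: W_def mem_Times_iff intro: open_Times)
  have X_t: "X q \<in> tangent_space (line_atlas A) q" and Z_t: "Z q \<in> tangent_space (line_atlas A) q" for q
    using vector_field_onD(2)[OF X] vector_field_onD(2)[OF Z] by auto
  have R_t: "?R \<in> tangent_space (line_atlas A) p"
    using vector_field_onD(2)[OF vector_field_radial[OF A]] by auto
  have K: "fibre_inner A gY X Z q = (\<Sum>b\<in>frame. \<Sum>c\<in>frame. T b c q)" if "q \<in> W" for q
  proof -
    have "snd q \<in> U" using that by (auto simp: W_def)
    from pulled_back_metric_in_chart[OF A U(1) g this X_t Z_t] show ?thesis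
      by (simp add: fibre_inner_def T_def x_def G_def o_def)
  qed
  have phi: "smooth_at A (snd p) (\<lambda>y. \<phi> y \<bullet> b)" for b
    by (rule smooth_atI[OF smooth_fun_on_chart_coord[OF A U(1)] U(2)])
  have x: "smooth_at (line_atlas A) p (x b)" for b
    unfolding x_def by (rule smooth_at_snd[OF A phi])
  have Gs: "smooth_at A (snd p) (G b c)" for b c
  proof -
    have "smooth_fun_on A U (G b c)"
      using g vector_field_on_coord_vector[OF A U(1)] unfolding riemannian_metric_def G_def by blast
    then show ?thesis by (rule smooth_atI[OF _ U(2)])
  qed
  have Xx: "smooth_at (line_atlas A) p (\<lambda>q. X q (x b))"
    and Zx: "smooth_at (line_atlas A) p (\<lambda>q. Z q (x b))" for b
    by (rule vector_field_smooth_at[OF X x], rule vector_field_smooth_at[OF Z x])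
  have XZ: "smooth_at (line_atlas A) p (\<lambda>q. X q (x b) * Z q (x c))" for b c
    by (rule smooth_at_mult[OF L Xx Zx])
  have Ts: "smooth_at (line_atlas A) p (T b c)" for b c
    unfolding T_def by (rule smooth_at_mult[OF L XZ smooth_at_snd[OF A Gs]])
  have Ts1: "smooth_at (line_atlas A) p (\<lambda>q. \<Sum>c\<in>frame. T b c q)" for b
    by (rule smooth_at_sum[OF L finite_frame Ts])
  have Ts2: "smooth_at (line_atlas A) p (\<lambda>q. \<Sum>b\<in>frame. \<Sum>c\<in>frame. T b c q)"
    by (rule smooth_at_sum[OF L finite_frame Ts1])
  show "smooth_at (line_atlas A) p (fibre_inner A gY X Z)"
    by (rule smooth_at_cong[OF L Ts2 W]) (simp add: K)
  have RT: "?R (T b c) = (u (x b) * Z p (x c) + X p (x b) * v (x c)) * G b c (snd p)" for b c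
    unfolding T_def tangent_vector_mult[OF L R_t XZ smooth_at_snd[OF A Gs]]
      tangent_vector_mult[OF L R_t Xx Zx]
    using u(2)[OF phi] v(2)[OF phi] by (simp add: x_def)
  have "?R (fibre_inner A gY X Z) = ?R (\<lambda>q. \<Sum>b\<in>frame. \<Sum>c\<in>frame. T b c q)"
    by (rule tangent_vector_local[OF L R_t W K])
  also have "\<dots> = (\<Sum>b\<in>frame. \<Sum>c\<in>frame. ?R (T b c))"
    unfolding tangent_vector_sum[OF L R_t finite_frame Ts1] tangent_vector_sum[OF L R_t finite_frame Ts] ..
  also have "\<dots> = (\<Sum>b\<in>frame. \<Sum>c\<in>frame. u (x b) * Z p (x c) * G b c (snd p))
      + (\<Sum>b\<in>frame. \<Sum>c\<in>frame. X p (x b) * v (x c) * G b c (snd p))"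
    unfolding RT by (simp add: distrib_right sum.distrib)
  also have "\<dots> = gY (snd p) (differential A snd p u) (differential A snd p (Z p))
      + gY (snd p) (differential A snd p (X p)) (differential A snd p v)"
    unfolding pulled_back_metric_in_chart[OF A U(1) g U(2) u(1) Z_t]
      pulled_back_metric_in_chart[OF A U(1) g U(2) X_t v(1)]
    by (simp add: x_def G_def)
  finally show "?R (fibre_inner A gY X Z) = \<dots>" .
qed

lemma twisted_metric_lincomb:
  assumes A: "smooth_atlas A" and g: "riemannian_metric A gY"
    and u: "u \<in> tangent_space (line_atlas A) p" and v: "v \<in> tangent_space (line_atlas A) p"
    and w: "w \<in> tangent_space (line_atlas A) p"
  shows "twisted_metric A \<psi> gY p (\<lambda>f. a * u f + b * v f) w
    = a * twisted_metric A \<psi> gY p u w + b * twisted_metric A \<psi> gY p v w"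
  unfolding twisted_metric_def differential_snd_lincomb
    riemannian_metricD(1)[OF g differential_snd_tangent[OF A u] differential_snd_tangent[OF A v]
      differential_snd_tangent[OF A w]]
  by (simp add: algebra_simps)

lemma twisted_metric_diff:
  assumes A: "smooth_atlas A" and g: "riemannian_metric A gY"
    and u: "u \<in> tangent_space (line_atlas A) p" and v: "v \<in> tangent_space (line_atlas A) p"
    and w: "w \<in> tangent_space (line_atlas A) p"
  shows "twisted_metric A \<psi> gY p (\<lambda>f. u f - v f) w
    = twisted_metric A \<psi> gY p u w - twisted_metric A \<psi> gY p v w"
  using twisted_metric_lincomb[OF A g u v w, where a = 1 and b = "-1"] by simp

lemma twisted_metric_sym:
  assumes A: "smooth_atlas A" and g: "riemannian_metric A gY"
    and u: "u \<in> tangent_space (line_atlas A) p" and v: "v \<in> tangent_space (line_atlas A) p"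
  shows "twisted_metric A \<psi> gY p u v = twisted_metric A \<psi> gY p v u"
  using riemannian_metricD(2)[OF g differential_snd_tangent[OF A u] differential_snd_tangent[OF A v]]
  by (simp add: twisted_metric_def)

text \<open>In other words \<open>g(\<partial>\<^sub>r, \<cdot>) = dr\<close>, since \<open>\<partial>\<^sub>r\<close> projects to zero.\<close>

lemma twisted_metric_radial:
  assumes A: "smooth_atlas A" and g: "riemannian_metric A gY"
    and v: "v \<in> tangent_space (line_atlas A) p"
  shows "twisted_metric A \<psi> gY p (radial_field A p) v = v fst"
  using riemannian_metric_zero[OF A g differential_snd_tangent[OF A v]]
  by (simp add: twisted_metric_def differential_snd_radial radial_field_fst[OF A])

lemma twisted_metric_definite:
  assumes A: "smooth_atlas A" and g: "riemannian_metric A gY" and \<psi>: "0 < \<psi> p"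
    and v: "v \<in> tangent_space (line_atlas A) p" and z: "twisted_metric A \<psi> gY p v v = 0"
  shows "v = (\<lambda>f. 0)"
proof -
  let ?d = "differential A snd p v"
  have d: "?d \<in> tangent_space A (snd p)" by (rule differential_snd_tangent[OF A v])
  have nn: "gY (snd p) ?d ?d \<ge> 0"
    using riemannian_metricD(3)[OF g d d] riemannian_metric_zero[OF A g d]
    by (cases "?d = (\<lambda>f. 0)") auto
  have s: "v fst * v fst + (\<psi> p)\<^sup>2 * gY (snd p) ?d ?d = 0" using z by (simp add: twisted_metric_def)
  have "v fst * v fst = 0 \<and> (\<psi> p)\<^sup>2 * gY (snd p) ?d ?d = 0"
    using s nn add_nonneg_eq_0_iff[of "v fst * v fst" "(\<psi> p)\<^sup>2 * gY (snd p) ?d ?d"] by simp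
  then have "v fst = 0" "gY (snd p) ?d ?d = 0" using \<psi> by auto
  then show ?thesis
    using riemannian_metricD(3)[OF g d d] line_tangent_vector_eq_zero[OF A v] by force
qed

text \<open>The first summand on the right is \<open>(L g)(X, Z)\<close>, where \<open>L\<close> is the Lie derivative along \<open>\<partial>\<^sub>r\<close>:
  only the factor \<open>\<psi>\<^sup>2\<close> varies along the \<open>r\<close>-lines. The fields \<open>[\<partial>\<^sub>r, X]\<close> and \<open>[\<partial>\<^sub>r, Z]\<close> are again
  represented by vectors \<open>u\<close> and \<open>v\<close> that act as they do on \<open>r\<close> and on functions lifted from \<open>\<Y>\<close>.\<close>

lemma radial_derivative_twisted_metric:
  assumes A: "smooth_atlas A" and g: "riemannian_metric A gY"
    and \<psi>: "smooth_at (line_atlas A) p \<psi>"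
    and X: "vector_field (line_atlas A) X" and Z: "vector_field (line_atlas A) Z"
    and u: "u \<in> tangent_space (line_atlas A) p" "u fst = radial_field A p (\<lambda>q. X q fst)"
      "\<And>h. smooth_at A (snd p) h \<Longrightarrow> u (h \<circ> snd) = radial_field A p (\<lambda>q. X q (h \<circ> snd))"
    and v: "v \<in> tangent_space (line_atlas A) p" "v fst = radial_field A p (\<lambda>q. Z q fst)"
      "\<And>h. smooth_at A (snd p) h \<Longrightarrow> v (h \<circ> snd) = radial_field A p (\<lambda>q. Z q (h \<circ> snd))"
  shows "radial_field A p (\<lambda>q. twisted_metric A \<psi> gY q (X q) (Z q))
    = 2 * \<psi> p * radial_field A p \<psi> * fibre_inner A gY X Z p
      + twisted_metric A \<psi> gY p u (Z p) + twisted_metric A \<psi> gY p (X p) v"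
proof -
  note L = smooth_atlas_line[OF A]
  let ?R = "radial_field A p" and ?K = "fibre_inner A gY X Z"
  have R_t: "?R \<in> tangent_space (line_atlas A) p"
    using vector_field_onD(2)[OF vector_field_radial[OF A]] by auto
  note K = radial_derivative_pulled_back_metric[OF A g X Z u(1,3) v(1,3)]
  have Xr: "smooth_at (line_atlas A) p (\<lambda>q. X q fst)" and Zr: "smooth_at (line_atlas A) p (\<lambda>q. Z q fst)"
    using vector_field_smooth_at[OF X smooth_at_fst[OF A]] vector_field_smooth_at[OF Z smooth_at_fst[OF A]]
    by auto
  have s1: "smooth_at (line_atlas A) p (\<lambda>q. X q fst * Z q fst)" by (rule smooth_at_mult[OF L Xr Zr])
  have s2: "smooth_at (line_atlas A) p (\<lambda>q. \<psi> q * \<psi> q)" by (rule smooth_at_mult[OF L \<psi> \<psi>])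
  have s3: "smooth_at (line_atlas A) p (\<lambda>q. \<psi> q * \<psi> q * ?K q)" by (rule smooth_at_mult[OF L s2 K(1)])
  have "(\<lambda>q. twisted_metric A \<psi> gY q (X q) (Z q)) = (\<lambda>q. X q fst * Z q fst + \<psi> q * \<psi> q * ?K q)"
    by (simp add: twisted_metric_def fibre_inner_def power2_eq_square)
  then show ?thesis
    using tangent_vector_add[OF L R_t s1 s3] tangent_vector_mult[OF L R_t Xr Zr]
      tangent_vector_mult[OF L R_t s2 K(1)] tangent_vector_mult[OF L R_t \<psi> \<psi>] K(2)
    by (simp add: twisted_metric_def fibre_inner_def u(2) v(2) power2_eq_square algebra_simps)
qed

section \<open>The covariant derivative of the radial field\<close>

lemma levi_civitaD:
  assumes "levi_civita A g nab" "vector_field A X" "vector_field A Y"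
  shows "vector_field A (nab X Y)"
    and "smooth_fun_on A UNIV a \<Longrightarrow>
      nab X (\<lambda>q f. a q * Y q f) p = (\<lambda>f. a p * nab X Y p f + X p a * Y p f)"
    and "(\<lambda>f. nab X Y p f - nab Y X p f) = lie_bracket A X Y p"
    and "vector_field A Z \<Longrightarrow>
      X p (\<lambda>q. g q (Y q) (Z q)) = g p (nab X Y p) (Z p) + g p (Y p) (nab X Z p)"
proof -
  have aff: "affine_connection A nab" and tf: "torsion_free A nab" and mc: "metric_compatible A g nab"
    using assms(1) unfolding levi_civita_def by simp_all
  show "vector_field A (nab X Y)"
    using aff[unfolded affine_connection_def, THEN conjunct1] assms(2,3) by simp
  show "smooth_fun_on A UNIV a \<Longrightarrow>
      nab X (\<lambda>q f. a q * Y q f) p = (\<lambda>f. a p * nab X Y p f + X p a * Y p f)"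
    using aff[unfolded affine_connection_def, THEN conjunct2, THEN conjunct2, THEN conjunct2]
      assms(2,3) by simp
  show "(\<lambda>f. nab X Y p f - nab Y X p f) = lie_bracket A X Y p"
    using tf assms(2,3) unfolding torsion_free_def by simp
  show "vector_field A Z \<Longrightarrow>
      X p (\<lambda>q. g q (Y q) (Z q)) = g p (nab X Y p) (Z p) + g p (Y p) (nab X Z p)"
    using mc assms(2,3) unfolding metric_compatible_def by simp
qed

text \<open>The Koszul formula for \<open>g(\<nabla>\<^sub>X \<partial>\<^sub>r, Z)\<close>. Metric compatibility is applied to the triples
  \<open>(X, \<partial>\<^sub>r, Z)\<close>, \<open>(Z, \<partial>\<^sub>r, X)\<close> and \<open>(\<partial>\<^sub>r, X, Z)\<close>. Because \<open>g(\<partial>\<^sub>r, \<cdot>) = dr\<close>, the terms \<open>X(Z r)\<close>, \<open>Z(X r)\<close> and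
  \<open>[X, Z] r\<close> cancel, which leaves \<open>2 g(\<nabla>\<^sub>X \<partial>\<^sub>r, Z) = (L g)(X, Z)\<close> with the Lie derivative \<open>L\<close> along \<open>\<partial>\<^sub>r\<close>.\<close>

lemma koszul_radial:
  assumes A: "smooth_atlas A" and g: "riemannian_metric A gY"
    and \<psi>: "smooth_fun_on (line_atlas A) UNIV \<psi>"
    and lc: "levi_civita (line_atlas A) (twisted_metric A \<psi> gY) nab"
    and X: "vector_field (line_atlas A) X" and Z: "vector_field (line_atlas A) Z"
  shows "twisted_metric A \<psi> gY p (nab X (radial_field A) p) (Z p)
    = \<psi> p * radial_field A p \<psi> * fibre_inner A gY X Z p"
proof -
  note L = smooth_atlas_line[OF A]
  let ?R = "radial_field A" and ?g = "twisted_metric A \<psi> gY"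
  note R = vector_field_radial[OF A]
  have nab_t: "nab X' Y' q \<in> tangent_space (line_atlas A) q"
    if "vector_field (line_atlas A) X'" "vector_field (line_atlas A) Y'" for X' Y' q
    using vector_field_onD(2)[OF levi_civitaD(1)[OF lc that]] by auto
  have t: "X' q \<in> tangent_space (line_atlas A) q" if "vector_field (line_atlas A) X'" for X' q
    using vector_field_onD(2)[OF that] by auto
  have torsion: "nab X' Y' p f - nab Y' X' p f = X' p (\<lambda>q. Y' q f) - Y' p (\<lambda>q. X' q f)"
    if "vector_field (line_atlas A) X'" "vector_field (line_atlas A) Y'" "smooth_at (line_atlas A) p f"
    for X' Y' f
  proof -
    from fun_cong[OF levi_civitaD(3)[OF lc that(1,2)], of p f]
    show ?thesis using that(3) by (simp add: lie_bracket_def)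
  qed
  note metric = levi_civitaD(4)[OF lc, of _ _ _ p]
  \<comment> \<open>\<open>br Y = [\<partial>\<^sub>r, Y]\<close>, written through the connection: this makes it a tangent vector.\<close>
  define br where "br X' = (\<lambda>f. nab ?R X' p f - nab X' ?R p f)" for X'
  have br_t: "br X' \<in> tangent_space (line_atlas A) p" if "vector_field (line_atlas A) X'" for X'
    using tangent_space_lincomb[OF L nab_t[OF R that] nab_t[OF that R], where a = 1 and b = "-1"] by (simp add: br_def)
  have br_fst: "br X' fst = ?R p (\<lambda>q. X' q fst)" if X': "vector_field (line_atlas A) X'" for X'
    using torsion[OF R X' smooth_at_fst[OF A]] tangent_vector_const[OF L t[OF X']]
    by (simp add: br_def radial_field_fst[OF A])
  have br_snd: "br X' (h \<circ> snd) = ?R p (\<lambda>q. X' q (h \<circ> snd))"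
    if X': "vector_field (line_atlas A) X'" and h: "smooth_at A (snd p) h" for X' h
    using torsion[OF R X' smooth_at_snd[OF A h]] tangent_vector_const[OF L t[OF X']]
    by (simp add: br_def)
  have \<psi>p: "smooth_at (line_atlas A) p \<psi>" by (rule smooth_atI[OF \<psi>]) simp
  have Lie: "?R p (\<lambda>q. ?g q (X q) (Z q)) = 2 * \<psi> p * ?R p \<psi> * fibre_inner A gY X Z p
      + ?g p (br X) (Z p) + ?g p (X p) (br Z)"
    by (rule radial_derivative_twisted_metric[OF A g \<psi>p X Z br_t[OF X] br_fst[OF X] br_snd[OF X]
          br_t[OF Z] br_fst[OF Z] br_snd[OF Z]])
  have dr: "(\<lambda>q. ?g q (?R q) (Y q)) = (\<lambda>q. Y q fst)" if "vector_field (line_atlas A) Y" for Y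
    using twisted_metric_radial[OF A g t[OF that]] by (simp add: fun_eq_iff)
  have drp: "?g p (?R p) w = w fst" if "w \<in> tangent_space (line_atlas A) p" for w
    using twisted_metric_radial[OF A g that] .
  have k1: "X p (\<lambda>q. Z q fst) = ?g p (nab X ?R p) (Z p) + nab X Z p fst"
    using metric[OF X R Z] unfolding dr[OF Z] drp[OF nab_t[OF X Z]] .
  have k2: "Z p (\<lambda>q. X q fst) = ?g p (nab Z ?R p) (X p) + nab Z X p fst"
    using metric[OF Z R X] unfolding dr[OF X] drp[OF nab_t[OF Z X]] .
  have k3: "?R p (\<lambda>q. ?g q (X q) (Z q)) = ?g p (nab ?R X p) (Z p) + ?g p (X p) (nab ?R Z p)"
    by (rule metric[OF R X Z])
  have b1: "?g p (br X) (Z p) = ?g p (nab ?R X p) (Z p) - ?g p (nab X ?R p) (Z p)"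
    unfolding br_def by (rule twisted_metric_diff[OF A g nab_t[OF R X] nab_t[OF X R] t[OF Z]])
  have "?g p (br Z) (X p) = ?g p (nab ?R Z p) (X p) - ?g p (nab Z ?R p) (X p)"
    unfolding br_def by (rule twisted_metric_diff[OF A g nab_t[OF R Z] nab_t[OF Z R] t[OF X]])
  then have b2: "?g p (X p) (br Z) = ?g p (X p) (nab ?R Z p) - ?g p (nab Z ?R p) (X p)"
    using twisted_metric_sym[OF A g t[OF X] br_t[OF Z]] twisted_metric_sym[OF A g t[OF X] nab_t[OF R Z]]
    by metis
  have "nab X Z p fst - nab Z X p fst = X p (\<lambda>q. Z q fst) - Z p (\<lambda>q. X q fst)"
    by (rule torsion[OF X Z smooth_at_fst[OF A]])
  then show ?thesis using Lie k1 k2 k3 b1 b2 by linarith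
qed

text \<open>The difference \<open>S\<close> of the two sides is a vector field, and \<open>koszul_radial\<close> with \<open>Z = S\<close> yields
  \<open>g(S, S) = 0\<close>. The formula is multiplied by \<open>\<psi>\<close> so that the coefficients of \<open>S\<close> are products of
  smooth functions, without quotients.\<close>

lemma connection_radial:
  assumes A: "smooth_atlas A" and g: "riemannian_metric A gY"
    and \<psi>: "smooth_fun_on (line_atlas A) UNIV \<psi>" "\<And>p. 0 < \<psi> p"
    and lc: "levi_civita (line_atlas A) (twisted_metric A \<psi> gY) nab"
    and X: "vector_field (line_atlas A) X"
  shows "\<psi> p * nab X (radial_field A) p f
    = radial_field A p \<psi> * (X p f - X p fst * radial_field A p f)"
proof -
  note L = smooth_atlas_line[OF A]
  let ?R = "radial_field A" and ?g = "twisted_metric A \<psi> gY"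
  note R = vector_field_radial[OF A]
  have N: "vector_field (line_atlas A) (nab X ?R)"
    by (rule levi_civitaD(1)[OF lc X R])
  define H where "H = (\<lambda>p f. (-1 * ?R p \<psi>) * X p f + (?R p \<psi> * X p fst) * ?R p f)"
  define S where "S = (\<lambda>p f. \<psi> p * nab X ?R p f + 1 * H p f)"
  have R\<psi>: "smooth_fun_on (line_atlas A) UNIV (\<lambda>p. ?R p \<psi>)" by (rule vector_field_onD(3)[OF R _ \<psi>(1)]) simp
  have Xr: "smooth_fun_on (line_atlas A) UNIV (\<lambda>p. X p fst)"
    by (rule vector_field_onD(3)[OF X _ smooth_fun_on_fst[OF A]]) simp
  note const = smooth_fun_on_const[OF L open_UNIV]
  have H: "vector_field (line_atlas A) H" unfolding H_def
    by (rule vector_field_lincomb[OF L X R smooth_fun_on_mult[OF L const R\<psi>] smooth_fun_on_mult[OF L R\<psi> Xr]])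
  have S: "vector_field (line_atlas A) S" unfolding S_def
    by (rule vector_field_lincomb[OF L N H \<psi>(1) const])
  have t: "X' q \<in> tangent_space (line_atlas A) q" if "vector_field (line_atlas A) X'" for X' q
    using vector_field_onD(2)[OF that] by auto
  have "?g p (S p) (S p) = \<psi> p * ?g p (nab X ?R p) (S p) + 1 * ?g p (H p) (S p)"
    using twisted_metric_lincomb[OF A g t[OF N] t[OF H] t[OF S], where a = "\<psi> p" and b = 1] by (simp add: S_def)
  also have "?g p (H p) (S p) = (-1 * ?R p \<psi>) * ?g p (X p) (S p) + (?R p \<psi> * X p fst) * S p fst"
    using twisted_metric_lincomb[OF A g t[OF X] t[OF R] t[OF S], where a = "-1 * ?R p \<psi>" and b = "?R p \<psi> * X p fst"]
    unfolding twisted_metric_radial[OF A g t[OF S]] by (simp add: H_def)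
  also have "?g p (X p) (S p) = X p fst * S p fst + (\<psi> p)\<^sup>2 * fibre_inner A gY X S p"
    by (simp add: twisted_metric_def fibre_inner_def)
  also have "?g p (nab X ?R p) (S p) = \<psi> p * ?R p \<psi> * fibre_inner A gY X S p"
    by (rule koszul_radial[OF A g \<psi>(1) lc X S])
  finally have "?g p (S p) (S p) = 0" by (simp add: algebra_simps power2_eq_square)
  then have "S p = (\<lambda>f. 0)" by (rule twisted_metric_definite[OF A g \<psi>(2) t[OF S]])
  from fun_cong[OF this, of f] show ?thesis by (simp add: S_def H_def algebra_simps)
qed

text \<open>All three parts are instances of
  \<open>\<nabla>\<^sub>X P = (\<partial>\<psi>/\<partial>r) X + (X(\<psi>) - (\<partial>\<psi>/\<partial>r) (X r)) \<partial>\<^sub>r\<close>.\<close>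

theorem corollary4p1:
  fixes A :: "('a::{second_countable_topology,t2_space}, 'e::finite_dim_inner) chart set"
    and gY :: "'a metric"
    and \<psi> :: "real \<times> 'a \<Rightarrow> real"
    and nab :: "(real \<times> 'a) connection"
    and P :: "real \<times> 'a \<Rightarrow> (real \<times> 'a) tvec"
  assumes "smooth_atlas A"
    and "riemannian_metric A gY"
    and "smooth_fun_on (line_atlas A) UNIV \<psi>"
    and "\<forall>p. 0 < \<psi> p"
    and "levi_civita (line_atlas A) (twisted_metric A \<psi> gY) nab"
    and "P = (\<lambda>p f. \<psi> p * radial_field A p f)"
  shows "(\<forall>p. nab (radial_field A) P p = (\<lambda>f. partial_r \<psi> p * radial_field A p f)) \<and>
    (\<forall>Y p. vector_field (line_atlas A) Y \<and> Y p \<in> factor_tangent_space A p \<longrightarrow>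
       nab Y P p = (\<lambda>f. Y p \<psi> * radial_field A p f + partial_r \<psi> p * Y p f)) \<and>
    (warped_product \<psi> \<longrightarrow> position_vector_field (line_atlas A) nab P)"
proof -
  note A = assms(1)
  note L = smooth_atlas_line[OF A]
  let ?R = "radial_field A"
  note R = vector_field_radial[OF A]
  have \<psi>_at: "smooth_at (line_atlas A) p \<psi>" for p by (rule smooth_atI[OF assms(3)]) simp
  have R\<psi>: "?R p \<psi> = partial_r \<psi> p" for p by (rule radial_field_eq_partial_r[OF \<psi>_at])
  have main: "nab X P p f = partial_r \<psi> p * X p f + (X p \<psi> - partial_r \<psi> p * X p fst) * ?R p f"
    if X: "vector_field (line_atlas A) X" for X p f
  proof -
    have "nab X P p = (\<lambda>f. \<psi> p * nab X ?R p f + X p \<psi> * ?R p f)"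
      unfolding assms(6) by (rule levi_civitaD(2)[OF assms(5) X R assms(3)])
    moreover have "\<psi> p * nab X ?R p f = partial_r \<psi> p * (X p f - X p fst * ?R p f)"
      using connection_radial[OF A assms(2,3) _ assms(5) X, of p f] assms(4) by (simp add: R\<psi>)
    ultimately show ?thesis by (simp add: algebra_simps)
  qed
  show ?thesis
  proof (intro conjI allI impI)
    show "nab ?R P p = (\<lambda>f. partial_r \<psi> p * ?R p f)" for p
      using main[OF R, of p] by (simp add: fun_eq_iff R\<psi> radial_field_fst[OF A])
  next
    fix Y p assume Y: "vector_field (line_atlas A) Y \<and> Y p \<in> factor_tangent_space A p"
    then have "Y p fst = 0" using factor_tangent_fst[OF A] by blast
    then show "nab Y P p = (\<lambda>f. Y p \<psi> * ?R p f + partial_r \<psi> p * Y p f)"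
      using main[of Y p] Y by (simp add: fun_eq_iff)
  next
    assume "warped_product \<psi>"
    then obtain F where F: "\<And>r y. \<psi> (r, y) = F r" unfolding warped_product_def by blast
    have "vector_field (line_atlas A) P"
      using vector_field_lincomb[OF L R R assms(3) smooth_fun_on_const[OF L open_UNIV, of 0]]
      by (simp add: assms(6))
    moreover have "nab X P p = (\<lambda>f. partial_r \<psi> p * X p f)" if X: "vector_field (line_atlas A) X" for X p
    proof -
      have "X p \<in> tangent_space (line_atlas A) p" using vector_field_onD(2)[OF X] by auto
      from tangent_vector_fst_fun[OF A this \<psi>_at F] show ?thesis
        using main[OF X, of p] by (simp add: fun_eq_iff R\<psi> mult.commute)
    qed
    ultimately show "position_vector_field (line_atlas A) nab P"
      unfolding position_vector_field_def by blast
  qed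
qed

end
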